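(* Let $M$ be an arbitrary $d\times d$ matrix dilation, $m=|\det M|$, $c\in\frac12\mathbb Z^d$, $n\in\mathbb N$. Let masks $m_0$ and $\widetilde m_0$ be symmetric with respect to the point $c$ in the sense (a), let $m_0$ have sum rule of order $n$ (with respect to $M$), and let $\widetilde m_0$ satisfy $$D^\beta\big(1-m_0(\xi)\overline{\widetilde m_0(\xi)}\big)\Big|_{\xi=\mathbf 0}=0\qquad\forall\beta\in\Delta_n.$$ Then there exist wavelet masks $m_\nu$ and $\widetilde m_\nu$, $\nu=1,\dots,m$ (for $m_0,\widetilde m_0$), each of which is symmetric or antisymmetric with respect to some point in the sense (a), and such that the wavelet masks $\widetilde m_\nu$, $\nu=1,\dots,m$, have vanishing moments of order $n$.
   Context: A matrix dilation $M$ is an integer $d\times d$ matrix all of whose eigenvalues are bigger than 1 in modulus; $M^*$ is its conjugate (transpose). A set of digits $D(M)=\{s_0,\dots,s_{m-1}\}$ contains exactly one representative of each coset of $\mathbb Z^d/M\mathbb Z^d$. $[\alpha]=\sum_j\alpha_j$, $\Delta_n=\{\alpha\in\mathbb Z^d_+:[\alpha]<n\}$. A trigonometric polynomial is a finite sum $t(\xi)=\sum_{k\in\mathbb Z^d}h_ke^{2\pi i(k,\xi)}$, $h_k\in\mathbb C$; a mask (refinable mask) is a trigonometric polynomial equal to 1 at $\mathbf 0$. The polyphase components $\tau_k$, $k=0,\dots,m-1$, of $t$ are the unique trigonometric polynomials with $t(\xi)=\frac1{\sqrt m}\sum_{k=0}^{m-1}e^{2\pi i(s_k,\xi)}\tau_k(M^*\xi)$.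 A trigonometric polynomial $t$ is symmetric (antisymmetric) with respect to a point $c\in\frac12\mathbb Z^d$ in the sense (a) if $t(\xi)=e^{2\pi i(2c,\xi)}t(-\xi)$ (resp. $t(\xi)=-e^{2\pi i(2c,\xi)}t(-\xi)$). $t$ has sum rule of order $n$ with respect to $M$ if $D^\beta(t(M^{*-1}\xi))|_{\xi=s}=0$ for all $s\in D(M^* )\setminus\{\mathbf 0\}$, $\beta\in\Delta_n$ (where $\mathbf 0\in D(M^* )$). $t$ has vanishing moments of order $n$ if $D^\beta t(\mathbf 0)=0$ for all $\beta\in\Delta_n$. Wavelet masks: given masks $m_0,\widetilde m_0$, trigonometric polynomials $m_\nu,\widetilde m_\nu$, $\nu=1,\dots,m$, are called wavelet masks for $m_0,\widetilde m_0$ if the $(m+1)\times m$ matrices $\mathcal M=(\mu_{\nu k})$, $\widetilde{\mathcal M}=(\widetilde\mu_{\nu k})$, $\nu=0,\dots,m$, $k=0,\dots,m-1$, where $\mu_{\nu k}$, $\widetilde\mu_{\nu k}$ are the polyphase components of $m_\nu$, $\widetilde m_\nu$, satisfy $\mathcal M^T\overline{\widetilde{\mathcal M}}=I_m$ (mixed extension principle). *)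

theory Defs
  imports "HOL-Analysis.Analysis"
begin

definition real_vec :: "int ^ 'd \<Rightarrow> real ^ 'd" where
  "real_vec k = (\<chi> i. real_of_int (k $ i))"

definition half_lattice :: "(real ^ 'd) set" where
  "half_lattice = {c. \<exists>k. c = (1/2) *\<^sub>R real_vec k}"

text \<open>Eigenvalues are the complex eigenvalues of the integer matrix.\<close>

definition matrix_dilation :: "int ^ 'd ^ 'd \<Rightarrow> bool" where
  "matrix_dilation M \<longleftrightarrow>
    (\<forall>(z::complex) v. v \<noteq> 0 \<and> map_matrix of_int M *v v = z *s v \<longrightarrow> norm z > 1)"

definition digit_set :: "int ^ 'd ^ 'd \<Rightarrow> (int ^ 'd) set \<Rightarrow> bool" where
  "digit_set A D \<longleftrightarrow> (\<forall>k. \<exists>!s. s \<in> D \<and> (\<exists>l. k - s = A *v l))"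

definition num_digits :: "int ^ 'd ^ 'd \<Rightarrow> nat" where
  "num_digits M = nat \<bar>det M\<bar>"

definition character :: "real ^ 'd \<Rightarrow> real ^ 'd \<Rightarrow> complex" where
  "character a \<xi> = exp (2 * of_real pi * \<i> * of_real (a \<bullet> \<xi>))"

definition trig_poly :: "(real ^ 'd \<Rightarrow> complex) \<Rightarrow> bool" where
  "trig_poly t \<longleftrightarrow>
    (\<exists>K h. finite K \<and> t = (\<lambda>\<xi>. \<Sum>k\<in>K. h k * character (real_vec k) \<xi>))"

definition refinable_mask :: "(real ^ 'd \<Rightarrow> complex) \<Rightarrow> bool" where
  "refinable_mask t \<longleftrightarrow> trig_poly t \<and> t 0 = 1"

definition symmetric_wrt :: "real ^ 'd \<Rightarrow> (real ^ 'd \<Rightarrow> complex) \<Rightarrow> bool" where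
  "symmetric_wrt c t \<longleftrightarrow> (\<forall>\<xi>. t \<xi> = character (2 *\<^sub>R c) \<xi> * t (- \<xi>))"

definition antisymmetric_wrt :: "real ^ 'd \<Rightarrow> (real ^ 'd \<Rightarrow> complex) \<Rightarrow> bool" where
  "antisymmetric_wrt c t \<longleftrightarrow> (\<forall>\<xi>. t \<xi> = - character (2 *\<^sub>R c) \<xi> * t (- \<xi>))"

definition partial_deriv :: "'d \<Rightarrow> (real ^ 'd \<Rightarrow> complex) \<Rightarrow> real ^ 'd \<Rightarrow> complex" where
  "partial_deriv i f x = vector_derivative (\<lambda>h. f (x + h *\<^sub>R axis i 1)) (at 0)"

text \<open>The partial derivatives are taken one coordinate after the other, along some fixed
  enumeration of the coordinates; on smooth functions the result does not depend on the
  enumeration (cf. \<open>multi_deriv_character\<close> below).\<close>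

definition multi_deriv ::
    "nat ^ 'd \<Rightarrow> (real ^ 'd \<Rightarrow> complex) \<Rightarrow> real ^ 'd \<Rightarrow> complex" where
  "multi_deriv \<beta> f =
    foldr (\<lambda>i. partial_deriv i ^^ (\<beta> $ i)) (SOME xs. set xs = UNIV \<and> distinct xs) f"

definition multi_indices :: "nat \<Rightarrow> (nat ^ 'd) set" where
  "multi_indices n = {\<alpha>. (\<Sum>j\<in>UNIV. \<alpha> $ j) < n}"

text \<open>\<open>D\<close> is a digit set of the transpose of \<open>M\<close> that contains \<open>0\<close>.\<close>

definition sum_rule ::
    "int ^ 'd ^ 'd \<Rightarrow> (int ^ 'd) set \<Rightarrow> nat \<Rightarrow> (real ^ 'd \<Rightarrow> complex) \<Rightarrow> bool" where
  "sum_rule M D n t \<longleftrightarrow> (\<forall>s \<in> D - {0}. \<forall>\<beta> \<in> multi_indices n.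
    multi_deriv \<beta> (\<lambda>\<xi>. t (matrix_inv (transpose (map_matrix real_of_int M)) *v \<xi>))
      (real_vec s) = 0)"

definition vanishing_moments :: "nat \<Rightarrow> (real ^ 'd \<Rightarrow> complex) \<Rightarrow> bool" where
  "vanishing_moments n t \<longleftrightarrow> (\<forall>\<beta> \<in> multi_indices n. multi_deriv \<beta> t 0 = 0)"

text \<open>The digits are enumerated as \<open>s 0, \<dots>, s (num_digits M - 1)\<close>; values of \<open>s\<close> and \<open>\<tau>\<close>
  at larger indices are irrelevant.\<close>

definition polyphase_components ::
    "int ^ 'd ^ 'd \<Rightarrow> (nat \<Rightarrow> int ^ 'd) \<Rightarrow> (real ^ 'd \<Rightarrow> complex) \<Rightarrow>
      (nat \<Rightarrow> real ^ 'd \<Rightarrow> complex) \<Rightarrow> bool" where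
  "polyphase_components M s t \<tau> \<longleftrightarrow>
    (\<forall>k < num_digits M. trig_poly (\<tau> k)) \<and>
    (\<forall>\<xi>. t \<xi> = 1 / of_real (sqrt (real (num_digits M))) *
      (\<Sum>k < num_digits M. character (real_vec (s k)) \<xi> *
         \<tau> k (transpose (map_matrix real_of_int M) *v \<xi>)))"

text \<open>The wavelet masks are \<open>w \<nu>\<close>, \<open>w' \<nu>\<close> for \<open>1 \<le> \<nu> \<le> num_digits M\<close>; index \<open>0\<close> is taken by the
  refinable masks. The last condition is the \<open>(j, k)\<close> entry of the matrix identity.\<close>

definition wavelet_masks ::
    "int ^ 'd ^ 'd \<Rightarrow> (nat \<Rightarrow> int ^ 'd) \<Rightarrow>
      (real ^ 'd \<Rightarrow> complex) \<Rightarrow> (real ^ 'd \<Rightarrow> complex) \<Rightarrow>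
      (nat \<Rightarrow> real ^ 'd \<Rightarrow> complex) \<Rightarrow> (nat \<Rightarrow> real ^ 'd \<Rightarrow> complex) \<Rightarrow> bool" where
  "wavelet_masks M s m0 m0' w w' \<longleftrightarrow>
    (\<forall>\<nu> \<in> {1..num_digits M}. trig_poly (w \<nu>) \<and> trig_poly (w' \<nu>)) \<and>
    (\<exists>\<mu> \<mu>'.
      (\<forall>\<nu> \<le> num_digits M.
        polyphase_components M s ((w(0 := m0)) \<nu>) (\<mu> \<nu>) \<and>
        polyphase_components M s ((w'(0 := m0')) \<nu>) (\<mu>' \<nu>)) \<and>
      (\<forall>\<xi>. \<forall>j < num_digits M. \<forall>k < num_digits M.
        (\<Sum>\<nu> \<le> num_digits M. \<mu> \<nu> j \<xi> * cnj (\<mu>' \<nu> k \<xi>)) = (if j = k then 1 else 0)))"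

lemma partial_deriv_character:
  "partial_deriv i (\<lambda>\<xi>. b * character a \<xi>) =
    (\<lambda>\<xi>. (2 * of_real pi * \<i> * of_real (a $ i)) * b * character a \<xi>)"
proof
  fix x
  have "((\<lambda>h. b * character a (x + h *\<^sub>R axis i 1)) has_vector_derivative
      (2 * of_real pi * \<i> * of_real (a $ i)) * b * character a x) (at 0)"
    unfolding character_def inner_add_right inner_scaleR_right inner_axis
    by (rule has_vector_derivative_real_field derivative_eq_intros refl | simp)+
  then show "partial_deriv i (\<lambda>\<xi>. b * character a \<xi>) x =
      (2 * of_real pi * \<i> * of_real (a $ i)) * b * character a x"
    unfolding partial_deriv_def by (rule vector_derivative_at)
qed

lemma multi_deriv_character:
  "multi_deriv \<beta> (character a) =
    (\<lambda>\<xi>. (\<Prod>i\<in>UNIV. (2 * of_real pi * \<i> * of_real (a $ i)) ^ (\<beta> $ i)) * character a \<xi>)"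
proof -
  have pow: "(partial_deriv i ^^ n) (\<lambda>\<xi>. b * character a \<xi>) =
      (\<lambda>\<xi>. (2 * of_real pi * \<i> * of_real (a $ i)) ^ n * b * character a \<xi>)" for i n b
  proof (induction n)
    case (Suc n)
    show ?case
      by (simp only: funpow.simps comp_apply Suc.IH partial_deriv_character power_Suc)
        (simp only: mult.assoc)
  qed simp
  have fold: "foldr (\<lambda>i. partial_deriv i ^^ (\<beta> $ i)) xs (character a) =
      (\<lambda>\<xi>. (\<Prod>i\<leftarrow>xs. (2 * of_real pi * \<i> * of_real (a $ i)) ^ (\<beta> $ i)) * character a \<xi>)" for xs
    by (induction xs) (simp_all only: foldr.simps list.map prod_list.Nil prod_list.Cons id_apply
      comp_apply pow mult_1_left)
  obtain xs :: "'a list" where "set xs = UNIV \<and> distinct xs"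
    using finite_distinct_list[of "UNIV :: 'a set"] by auto
  then have ex: "\<exists>xs :: 'a list. set xs = UNIV \<and> distinct xs"
    by blast
  define ys :: "'a list" where "ys = (SOME xs. set xs = UNIV \<and> distinct xs)"
  have ys: "set ys = UNIV" "distinct ys"
    using someI_ex[OF ex] by (simp_all only: ys_def)
  show ?thesis
    unfolding multi_deriv_def fold ys_def[symmetric]
      prod.distinct_set_conv_list[OF ys(2), unfolded ys(1)] ..
qed

end

theory Submission
  imports Defs
begin

text \<open>Write \<open>m\<close> for the number of digits, \<open>\<tau> j\<close> and \<open>\<tau>' j\<close> for the polyphase components of
  the two refinable masks, and \<open>M*\<close> for the transpose. Take the masks \<open>e_j = m^{-1/2} exp (2 pi i (s_j, \<xi>))\<close>;
  their polyphase rows form the identity matrix. The mixed extension principle then forces the dual masks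
  \<open>f_j(\<xi>) = e_j(\<xi>) - cnj (\<tau> j (M* \<xi>)) m0'(\<xi>)\<close>, and two things have to be explained.

  Vanishing moments. Inverting the polyphase decomposition expresses \<open>\<tau> j (M* \<xi>)\<close> as an average of the
  values \<open>m0 (\<xi> + M*^{-1} l)\<close> against characters, \<open>l\<close> running over the dual digits (lemma
  \<open>polyphase_inversion\<close>). By the sum rule all terms with \<open>l \<noteq> 0\<close> vanish to order \<open>n\<close> at the origin, so
  \<open>cnj (\<tau> j (M* \<xi>))\<close> agrees to order \<open>n\<close> with \<open>cnj (m0 \<xi>) e_j(\<xi>)\<close>, and \<open>f_j\<close> with
  \<open>e_j (1 - cnj m0 m0')\<close>, which vanishes to order \<open>n\<close> by assumption (lemma \<open>flat_dual_digit_mask\<close>).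
  The inversion needs that \<open>M\<close> and its transpose have equally many digits, which follows from the
  orthogonality of the characters of the quotient group (lemma \<open>card_digit_set_transpose\<close>).

  Symmetry. The reflection \<open>k \<mapsto> 2 c - k\<close> of the frequencies permutes the cosets of \<open>M Z^d\<close> by an
  involution \<open>\<sigma>\<close>, and reflection about the midpoint of \<open>s_j\<close> and \<open>s_{\<sigma> j}\<close> exchanges \<open>e_j\<close> with
  \<open>e_{\<sigma> j}\<close> and \<open>f_j\<close> with \<open>f_{\<sigma> j}\<close> (lemma \<open>dual_digit_mask_reflects\<close>). Hence masks of fixed digits are
  symmetric already, while an exchanged pair is replaced by its normalised sum and difference. This is
  one and the same real orthogonal change of basis on both sides, so it preserves the extension
  principle (lemma \<open>mix_orthogonal\<close>), and linear combinations keep the vanishing moments.\<close>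

section \<open>Exponential sums\<close>

(* The library turns the action of a transpose into a row vector product; here the transposes
   are the matrices that act on frequencies and must stay visible. *)
declare transpose_matrix_vector [simp del]

lemma character_0_left [simp]: "character 0 \<xi> = 1"
  and character_0_right [simp]: "character a 0 = 1"
  by (simp_all add: character_def)

lemma character_add_left: "character (a + b) \<xi> = character a \<xi> * character b \<xi>"
  and character_add_right: "character a (\<xi> + \<eta>) = character a \<xi> * character a \<eta>"
  by (simp_all add: character_def inner_add exp_add ring_distribs)

lemma character_minus_right: "character a (- \<xi>) = character (- a) \<xi>"
  by (simp add: character_def)

lemma cnj_character: "cnj (character a \<xi>) = character (- a) \<xi>"
  by (simp add: character_def exp_cnj)

lemma character_matrix: "character a (A *v \<xi>) = character (transpose A *v a) \<xi>"
  by (simp add: character_def dot_lmul_matrix transpose_matrix_vector)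

text \<open>Finite combinations of characters with frequencies in a prescribed set. Trigonometric polynomials
  are those with integer frequencies; arbitrary real frequencies are needed as well, because the
  sum rule differentiates \<open>t (M*^{-1} \<xi>)\<close>, whose frequencies are no longer integers.\<close>

inductive_set exp_sums :: "(real ^ 'd) set \<Rightarrow> (real ^ 'd \<Rightarrow> complex) set" for \<Lambda> where
  zero: "(\<lambda>\<xi>. 0) \<in> exp_sums \<Lambda>"
| add_term: "a \<in> \<Lambda> \<Longrightarrow> f \<in> exp_sums \<Lambda> \<Longrightarrow> (\<lambda>\<xi>. b * character a \<xi> + f \<xi>) \<in> exp_sums \<Lambda>"

lemma exp_sums_term: "a \<in> \<Lambda> \<Longrightarrow> (\<lambda>\<xi>. b * character a \<xi>) \<in> exp_sums \<Lambda>"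
  using exp_sums.add_term[OF _ exp_sums.zero, of a \<Lambda> b] by simp

lemma exp_sums_character: "a \<in> \<Lambda> \<Longrightarrow> character a \<in> exp_sums \<Lambda>"
  using exp_sums_term[of a \<Lambda> 1] by simp

lemma exp_sums_const: "0 \<in> \<Lambda> \<Longrightarrow> (\<lambda>\<xi>. b) \<in> exp_sums \<Lambda>"
  using exp_sums_term[of 0 \<Lambda> b] by simp

lemma exp_sums_add:
  assumes "f \<in> exp_sums \<Lambda>" "g \<in> exp_sums \<Lambda>"
  shows "(\<lambda>\<xi>. f \<xi> + g \<xi>) \<in> exp_sums \<Lambda>"
  using assms(1)
proof induction
  case zero
  then show ?case using assms(2) by simp
next
  case (add_term a f b)
  from exp_sums.add_term[OF this(1,3), of b] show ?case by (simp add: add.assoc)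
qed

lemma exp_sums_cmult:
  assumes "f \<in> exp_sums \<Lambda>"
  shows "(\<lambda>\<xi>. b * f \<xi>) \<in> exp_sums \<Lambda>"
  using assms
proof induction
  case zero
  show ?case by (simp add: exp_sums.zero)
next
  case (add_term a f b')
  from exp_sums.add_term[OF this(1,3), of "b * b'"] show ?case by (simp add: ring_distribs mult.assoc)
qed

lemma exp_sums_diff:
  assumes "f \<in> exp_sums \<Lambda>" "g \<in> exp_sums \<Lambda>"
  shows "(\<lambda>\<xi>. f \<xi> - g \<xi>) \<in> exp_sums \<Lambda>"
  using exp_sums_add[OF assms(1) exp_sums_cmult[OF assms(2), of "-1"]] by simp

lemma exp_sums_sum:
  "(\<And>i. i \<in> I \<Longrightarrow> f i \<in> exp_sums \<Lambda>) \<Longrightarrow> (\<lambda>\<xi>. \<Sum>i\<in>I. f i \<xi>) \<in> exp_sums \<Lambda>"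
  by (induction I rule: infinite_finite_induct) (simp_all add: exp_sums.zero exp_sums_add)

lemma exp_sums_mult:
  assumes "\<And>a b. a \<in> \<Lambda> \<Longrightarrow> b \<in> \<Lambda> \<Longrightarrow> a + b \<in> \<Lambda>"
    and "f \<in> exp_sums \<Lambda>" "g \<in> exp_sums \<Lambda>"
  shows "(\<lambda>\<xi>. f \<xi> * g \<xi>) \<in> exp_sums \<Lambda>"
proof -
  have shift: "(\<lambda>\<xi>. character a \<xi> * h \<xi>) \<in> exp_sums \<Lambda>"
    if "a \<in> \<Lambda>" "h \<in> exp_sums \<Lambda>" for a h
    using that(2)
  proof induction
    case zero
    show ?case by (simp add: exp_sums.zero)
  next
    case (add_term a' h b)
    then have "(\<lambda>\<xi>. b * character (a + a') \<xi> + character a \<xi> * h \<xi>) \<in> exp_sums \<Lambda>"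
      by (intro exp_sums.add_term assms(1) that(1))
    then show ?case by (simp add: character_add_left ring_distribs mult_ac)
  qed
  show ?thesis
    using assms(2)
  proof induction
    case zero
    show ?case by (simp add: exp_sums.zero)
  next
    case (add_term a f b)
    from exp_sums_add[OF exp_sums_cmult[OF shift[OF this(1) assms(3)], of b] this(3)]
    show ?case by (simp add: ring_distribs mult_ac)
  qed
qed

lemma exp_sums_cnj:
  assumes "\<And>a. a \<in> \<Lambda> \<Longrightarrow> - a \<in> \<Lambda>" and "f \<in> exp_sums \<Lambda>"
  shows "(\<lambda>\<xi>. cnj (f \<xi>)) \<in> exp_sums \<Lambda>"
  using assms(2)
proof induction
  case zero
  show ?case by (simp add: exp_sums.zero)
next
  case (add_term a f b)
  from exp_sums.add_term[OF assms(1)[OF this(1)] this(3), of "cnj b"]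
  show ?case by (simp add: cnj_character)
qed

lemma exp_sums_affine:
  assumes "\<And>a. a \<in> \<Lambda> \<Longrightarrow> transpose A *v a \<in> \<Lambda>'" and "f \<in> exp_sums \<Lambda>"
  shows "(\<lambda>\<xi>. f (A *v \<xi> + b)) \<in> exp_sums \<Lambda>'"
  using assms(2)
proof induction
  case zero
  show ?case by (simp add: exp_sums.zero)
next
  case (add_term a f h)
  from exp_sums.add_term[OF assms(1)[OF this(1)] this(3), of "h * character a b"]
  show ?case by (simp add: character_add_right character_matrix mult_ac)
qed

lemma exp_sums_mono: "\<Lambda> \<subseteq> \<Lambda>' \<Longrightarrow> f \<in> exp_sums \<Lambda> \<Longrightarrow> f \<in> exp_sums \<Lambda>'"
  by (erule exp_sums.induct) (auto intro: exp_sums.intros)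

lemma trig_poly_iff_exp_sums: "trig_poly t \<longleftrightarrow> t \<in> exp_sums (range real_vec)"
proof
  assume "trig_poly t"
  then obtain K h where "finite K" "t = (\<lambda>\<xi>. \<Sum>k\<in>K. h k * character (real_vec k) \<xi>)"
    unfolding trig_poly_def by blast
  then show "t \<in> exp_sums (range real_vec)"
    by (simp add: exp_sums_sum exp_sums_term)
next
  assume "t \<in> exp_sums (range real_vec)"
  then show "trig_poly t"
  proof induction
    case zero
    show ?case unfolding trig_poly_def by (intro exI[of _ "{}"]) simp
  next
    case (add_term a f b)
    obtain k where k: "a = real_vec k" using add_term by blast
    obtain K h where K: "finite K" "f = (\<lambda>\<xi>. \<Sum>k\<in>K. h k * character (real_vec k) \<xi>)"
      using add_term unfolding trig_poly_def by blast
    define h' where "h' = (\<lambda>x. (if x \<in> K then h x else 0) + (if x = k then b else 0))"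
    have "(\<Sum>x\<in>insert k K. h' x * character (real_vec x) \<xi>) = b * character a \<xi> + f \<xi>" for \<xi>
    proof -
      have "(\<Sum>x\<in>insert k K. h' x * character (real_vec x) \<xi>) =
        (\<Sum>x\<in>insert k K. if x \<in> K then h x * character (real_vec x) \<xi> else 0) +
        (\<Sum>x\<in>insert k K. if x = k then b * character (real_vec x) \<xi> else 0)"
        unfolding sum.distrib[symmetric] by (intro sum.cong) (auto simp: h'_def ring_distribs)
      then show ?thesis
        using K(1) by (auto simp: K(2) k sum.If_cases Int_absorb1 Int_absorb2 subset_insertI)
    qed
    then show ?case
      unfolding trig_poly_def using K(1) by (intro exI[of _ "insert k K"] exI[of _ h']) auto
  qed
qed

text \<open>Partial derivatives are defined through a choice that means nothing for functions that are not
  differentiable, so existence and stability of the class are proved together.\<close>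

lemma exp_sums_partial_deriv:
  assumes "f \<in> exp_sums \<Lambda>"
  shows exp_sums_has_partial_deriv: "((\<lambda>h. f (x + h *\<^sub>R axis i 1)) has_vector_derivative
      partial_deriv i f x) (at 0)" (is "?P f")
    and partial_deriv_in_exp_sums: "partial_deriv i f \<in> exp_sums \<Lambda>"
proof -
  have "(\<forall>x. ((\<lambda>h. f (x + h *\<^sub>R axis i 1)) has_vector_derivative partial_deriv i f x) (at 0)) \<and>
      partial_deriv i f \<in> exp_sums \<Lambda>"
    using assms
  proof induction
    case zero
    show ?case by (auto simp: partial_deriv_def intro: exp_sums.zero)
  next
    case (add_term a f b)
    define c where "c = 2 * of_real pi * \<i> * of_real (a $ i)"
    have char: "((\<lambda>h. b * character a (x + h *\<^sub>R axis i 1)) has_vector_derivative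
        c * b * character a x) (at 0)" for x
      unfolding character_def inner_add_right inner_scaleR_right inner_axis c_def
      by (rule has_vector_derivative_real_field derivative_eq_intros refl | simp)+
    have D: "((\<lambda>h. b * character a (x + h *\<^sub>R axis i 1) + f (x + h *\<^sub>R axis i 1))
        has_vector_derivative (c * b * character a x + partial_deriv i f x)) (at 0)" for x
      using char add_term.IH by (intro has_vector_derivative_add) auto
    then have "partial_deriv i (\<lambda>\<xi>. b * character a \<xi> + f \<xi>) =
        (\<lambda>x. c * b * character a x + partial_deriv i f x)"
      unfolding partial_deriv_def[of i "\<lambda>\<xi>. b * character a \<xi> + f \<xi>"]
      by (intro ext vector_derivative_at)
    then show ?case
      using D add_term by (auto intro: exp_sums.add_term)
  qed
  then show "?P f" "partial_deriv i f \<in> exp_sums \<Lambda>" by blast+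
qed

lemma partial_deriv_eqI:
  "(\<And>x. ((\<lambda>h. f (x + h *\<^sub>R axis i 1)) has_vector_derivative g x) (at 0)) \<Longrightarrow> partial_deriv i f = g"
  unfolding partial_deriv_def by (intro ext vector_derivative_at)

lemma partial_deriv_add:
  assumes "f \<in> exp_sums \<Lambda>" "g \<in> exp_sums \<Lambda>"
  shows "partial_deriv i (\<lambda>\<xi>. f \<xi> + g \<xi>) = (\<lambda>\<xi>. partial_deriv i f \<xi> + partial_deriv i g \<xi>)"
  by (rule partial_deriv_eqI) (intro has_vector_derivative_add exp_sums_has_partial_deriv[where \<Lambda> = \<Lambda>] assms)

lemma partial_deriv_zero: "partial_deriv i (\<lambda>\<xi>. 0) = (\<lambda>\<xi>. 0)"
  by (rule partial_deriv_eqI) simp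

lemma partial_deriv_add_term:
  assumes "f \<in> exp_sums \<Lambda>"
  shows "partial_deriv i (\<lambda>\<xi>. b * character a \<xi> + f \<xi>) =
    (\<lambda>\<xi>. (2 * of_real pi * \<i> * of_real (a $ i)) * b * character a \<xi> + partial_deriv i f \<xi>)"
  using partial_deriv_add[OF exp_sums_term exp_sums_mono, of a UNIV \<Lambda> f i b] assms
  by (simp only: partial_deriv_character UNIV_I subset_UNIV)

lemma partial_deriv_mult:
  assumes "f \<in> exp_sums \<Lambda>" "g \<in> exp_sums \<Lambda>"
  shows "partial_deriv i (\<lambda>\<xi>. f \<xi> * g \<xi>) =
    (\<lambda>\<xi>. f \<xi> * partial_deriv i g \<xi> + partial_deriv i f \<xi> * g \<xi>)"
proof (rule partial_deriv_eqI)
  fix x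
  show "((\<lambda>h. f (x + h *\<^sub>R axis i 1) * g (x + h *\<^sub>R axis i 1)) has_vector_derivative
      f x * partial_deriv i g x + partial_deriv i f x * g x) (at 0)"
    using has_vector_derivative_mult[OF exp_sums_has_partial_deriv[OF assms(1), of x i]
        exp_sums_has_partial_deriv[OF assms(2), of x i]]
    by simp
qed

lemma partial_deriv_cnj:
  assumes "f \<in> exp_sums \<Lambda>"
  shows "partial_deriv i (\<lambda>\<xi>. cnj (f \<xi>)) = (\<lambda>\<xi>. cnj (partial_deriv i f \<xi>))"
  by (rule partial_deriv_eqI) (intro has_vector_derivative_cnj exp_sums_has_partial_deriv[where \<Lambda> = \<Lambda>] assms)

lemma partial_deriv_affine:
  fixes A :: "real ^ 'e ^ 'd"
  assumes "f \<in> exp_sums \<Lambda>"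
  shows "partial_deriv i (\<lambda>\<xi>. f (A *v \<xi> + b)) =
    (\<lambda>\<xi>. \<Sum>j\<in>UNIV. of_real (A $ j $ i) * partial_deriv j f (A *v \<xi> + b))"
  using assms
proof induction
  case zero
  show ?case by (simp add: partial_deriv_zero)
next
  case (add_term a f h)
  define C where "C = 2 * of_real pi * \<i> * h"
  have char: "partial_deriv i (\<lambda>\<xi>. h * character a (A *v \<xi> + b)) =
     (\<lambda>\<xi>. C * of_real ((transpose A *v a) $ i) * character a (A *v \<xi> + b))"
    unfolding character_add_right character_matrix
    using partial_deriv_character[of i "h * character a b" "transpose A *v a"]
    by (simp add: C_def mult_ac)
  have add: "partial_deriv j (\<lambda>\<xi>. h * character a \<xi> + f \<xi>) =
      (\<lambda>\<xi>. C * of_real (a $ j) * character a \<xi> + partial_deriv j f \<xi>)" for j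
    unfolding partial_deriv_add_term[OF add_term(2)] by (simp add: C_def mult_ac)
  have E: "(\<lambda>\<xi>. h * character a (A *v \<xi> + b)) \<in> exp_sums UNIV" "(\<lambda>\<xi>. f (A *v \<xi> + b)) \<in> exp_sums UNIV"
    using exp_sums_affine[OF _ exp_sums_term[OF add_term(1)], of A UNIV h b]
      exp_sums_affine[OF _ add_term(2), of A UNIV b] by auto
  have "partial_deriv i (\<lambda>\<xi>. h * character a (A *v \<xi> + b) + f (A *v \<xi> + b)) =
     (\<lambda>\<xi>. C * of_real (\<Sum>j\<in>UNIV. A $ j $ i * a $ j) * character a (A *v \<xi> + b) +
        (\<Sum>j\<in>UNIV. of_real (A $ j $ i) * partial_deriv j f (A *v \<xi> + b)))"
    unfolding partial_deriv_add[OF E] char add_term.IH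
    by (simp add: matrix_vector_mult_def transpose_def)
  then show ?case
    unfolding add by (simp add: sum.distrib ring_distribs sum_distrib_left sum_distrib_right mult_ac)
qed

lemma partial_deriv_commute:
  assumes "f \<in> exp_sums \<Lambda>"
  shows "partial_deriv i (partial_deriv j f) = partial_deriv j (partial_deriv i f)"
  using assms
proof induction
  case zero
  show ?case by (simp add: partial_deriv_zero)
next
  case (add_term a f h)
  note E = partial_deriv_in_exp_sums[OF add_term(2)]
  show ?case
    unfolding partial_deriv_add_term[OF add_term(2)] partial_deriv_add_term[OF E] add_term.IH
    by (simp only: mult_ac)
qed

section \<open>Vanishing to finite order\<close>

text \<open>Vanishing at \<open>x\<close> of all derivatives of order below \<open>n\<close>. Peeling off one derivative at a
  time, rather than quantifying over multi-indices, turns the product rule and the chain rule into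
  one-step inductions.\<close>

primrec flat :: "nat \<Rightarrow> real ^ 'd \<Rightarrow> (real ^ 'd \<Rightarrow> complex) \<Rightarrow> bool" where
  "flat 0 x f \<longleftrightarrow> True"
| "flat (Suc n) x f \<longleftrightarrow> f x = 0 \<and> (\<forall>i. flat n x (partial_deriv i f))"

lemma flat_pred: "flat (Suc n) x f \<Longrightarrow> flat n x f"
  by (induction n arbitrary: f) auto

lemma flat_antimono: "m \<le> n \<Longrightarrow> flat n x f \<Longrightarrow> flat m x f"
  by (induction rule: inc_induct) (auto dest: flat_pred simp del: flat.simps)

lemma flat_zero: "flat n x (\<lambda>\<xi>. 0)"
  by (induction n) (simp_all add: partial_deriv_zero)

lemma flat_add:
  assumes "f \<in> exp_sums UNIV" "g \<in> exp_sums UNIV" "flat n x f" "flat n x g"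
  shows "flat n x (\<lambda>\<xi>. f \<xi> + g \<xi>)"
  using assms
  by (induction n arbitrary: f g)
    (simp_all add: partial_deriv_add[where \<Lambda> = UNIV] partial_deriv_in_exp_sums)

lemma flat_sum:
  assumes "\<And>i. i \<in> I \<Longrightarrow> f i \<in> exp_sums UNIV" "\<And>i. i \<in> I \<Longrightarrow> flat n x (f i)"
  shows "flat n x (\<lambda>\<xi>. \<Sum>i\<in>I. f i \<xi>)"
  using assms
  by (induction I rule: infinite_finite_induct) (auto intro!: flat_zero flat_add exp_sums_sum)

text \<open>The functions flat at a point form an ideal. In the product rule the summand with the derivative
  on \<open>g\<close> only needs \<open>f\<close> to be flat of the lower order, which it is.\<close>

lemma flat_mult:
  assumes "f \<in> exp_sums UNIV" "g \<in> exp_sums UNIV" "flat n x f"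
  shows "flat n x (\<lambda>\<xi>. f \<xi> * g \<xi>)"
  using assms
proof (induction n arbitrary: f g)
  case (Suc n)
  have "flat n x f" using Suc.prems(3) by (rule flat_pred)
  then show ?case
    using Suc by (auto simp: partial_deriv_mult[where \<Lambda> = UNIV] partial_deriv_in_exp_sums
        intro!: flat_add exp_sums_mult)
qed simp

lemma flat_cnj:
  assumes "f \<in> exp_sums UNIV" "flat n x f"
  shows "flat n x (\<lambda>\<xi>. cnj (f \<xi>))"
  using assms
  by (induction n arbitrary: f) (simp_all add: partial_deriv_cnj[where \<Lambda> = UNIV] partial_deriv_in_exp_sums)

lemma flat_affine:
  fixes A :: "real ^ 'e ^ 'd"
  assumes "f \<in> exp_sums UNIV" "flat n (A *v x + b) f"
  shows "flat n x (\<lambda>\<xi>. f (A *v \<xi> + b))"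
  using assms
proof (induction n arbitrary: f)
  case (Suc n)
  have E: "(\<lambda>\<xi>. partial_deriv j f (A *v \<xi> + b)) \<in> exp_sums UNIV" for j
    by (rule exp_sums_affine[OF _ partial_deriv_in_exp_sums[OF Suc.prems(1)]]) simp
  have "flat n x (\<lambda>\<xi>. partial_deriv j f (A *v \<xi> + b) * of_real (A $ j $ i))" for i j
    using Suc by (intro flat_mult E exp_sums_const) (auto simp: partial_deriv_in_exp_sums)
  then have "flat n x (\<lambda>\<xi>. \<Sum>j\<in>UNIV. of_real (A $ j $ i) * partial_deriv j f (A *v \<xi> + b))" for i
    by (intro flat_sum) (auto intro: exp_sums_cmult E simp: mult.commute)
  then show ?case
    using Suc.prems partial_deriv_affine[OF Suc.prems(1), of _ A b] by simp
qed simp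

lemma funpow_partial_deriv_in_exp_sums:
  "f \<in> exp_sums \<Lambda> \<Longrightarrow> (partial_deriv i ^^ k) f \<in> exp_sums \<Lambda>"
  by (induction k) (auto intro: partial_deriv_in_exp_sums)

lemma funpow_partial_deriv_commute:
  assumes "f \<in> exp_sums \<Lambda>"
  shows "(partial_deriv j ^^ k) (partial_deriv i f) = partial_deriv i ((partial_deriv j ^^ k) f)"
  by (induction k)
    (simp_all add: partial_deriv_commute[OF funpow_partial_deriv_in_exp_sums[OF assms]])

text \<open>Partial derivatives of exponential sums commute, so an extra derivative can be moved to its place
  in the fixed enumeration of the coordinates.\<close>

lemma multi_deriv_partial_deriv:
  fixes \<beta> :: "nat ^ 'd"
  assumes "f \<in> exp_sums \<Lambda>"
  shows "multi_deriv \<beta> (partial_deriv i f) = multi_deriv (\<beta> + axis i 1) f"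
proof -
  define D where "D = (\<lambda>\<beta> :: nat ^ 'd. foldr (\<lambda>i. partial_deriv i ^^ (\<beta> $ i)))"
  have E: "D \<beta> xs f \<in> exp_sums \<Lambda>" for xs \<beta>
    by (induction xs) (simp_all add: D_def assms funpow_partial_deriv_in_exp_sums)
  have commute: "D \<beta> xs (partial_deriv i f) = partial_deriv i (D \<beta> xs f)" for xs
  proof (induction xs)
    case (Cons j xs)
    then show ?case using funpow_partial_deriv_commute[OF E[of \<beta> xs]] by (simp add: D_def)
  qed (simp add: D_def)
  have other: "D (\<beta> + axis i 1) xs f = D \<beta> xs f" if "i \<notin> set xs" for xs
    using that by (induction xs) (auto simp: D_def axis_def)
  have step: "D (\<beta> + axis i 1) xs f = partial_deriv i (D \<beta> xs f)" if "distinct xs" "i \<in> set xs" for xs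
    using that
  proof (induction xs)
    case (Cons j xs)
    show ?case
    proof (cases "i = j")
      case True
      have "D (\<beta> + axis i 1) (j # xs) f = (partial_deriv i ^^ Suc (\<beta> $ i)) (D \<beta> xs f)"
        using other[of xs] Cons.prems(1) True by (simp add: D_def axis_def)
      then show ?thesis by (simp add: D_def True)
    next
      case False
      then have "D (\<beta> + axis i 1) (j # xs) f = (partial_deriv j ^^ (\<beta> $ j)) (D (\<beta> + axis i 1) xs f)"
        by (simp add: D_def axis_def)
      also have "\<dots> = (partial_deriv j ^^ (\<beta> $ j)) (partial_deriv i (D \<beta> xs f))"
        using Cons False by simp
      also have "\<dots> = partial_deriv i ((partial_deriv j ^^ (\<beta> $ j)) (D \<beta> xs f))"
        by (rule funpow_partial_deriv_commute[OF E])
      finally show ?thesis by (simp add: D_def)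
    qed
  qed simp
  have "\<exists>xs :: 'd list. set xs = UNIV \<and> distinct xs"
    using finite_distinct_list[of "UNIV :: 'd set"] by auto
  from someI_ex[OF this] show ?thesis
    using commute step unfolding multi_deriv_def D_def by simp
qed

lemma multi_deriv_0: "multi_deriv 0 f = f"
proof -
  have "foldr (\<lambda>i. partial_deriv i ^^ 0) xs f = f" for xs :: "'a list"
    by (induction xs) simp_all
  then show ?thesis by (simp add: multi_deriv_def)
qed

lemma flat_funpow: "flat (k + n) x f \<Longrightarrow> flat n x ((partial_deriv i ^^ k) f)"
  by (induction k arbitrary: n) (simp_all, metis add_Suc_right flat.simps(2))

lemma flat_imp_multi_deriv_eq_0:
  fixes \<beta> :: "nat ^ 'd"
  assumes "flat n x f" "\<beta> \<in> multi_indices n"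
  shows "multi_deriv \<beta> f x = 0"
proof -
  have aux: "flat k x (foldr (\<lambda>i. partial_deriv i ^^ (\<beta> $ i)) xs f)"
    if "flat ((\<Sum>i\<leftarrow>xs. \<beta> $ i) + k) x f" for k xs
    using that
  proof (induction xs arbitrary: k)
    case (Cons i xs)
    have "flat (\<beta> $ i + k) x (foldr (\<lambda>i. partial_deriv i ^^ (\<beta> $ i)) xs f)"
      using Cons.prems by (intro Cons.IH) (simp add: add_ac)
    then show ?case by (simp add: flat_funpow)
  qed simp
  define ys :: "'d list" where "ys = (SOME xs. set xs = UNIV \<and> distinct xs)"
  have "\<exists>xs :: 'd list. set xs = UNIV \<and> distinct xs"
    using finite_distinct_list[of "UNIV :: 'd set"] by auto
  from someI_ex[OF this] have ys: "set ys = UNIV" "distinct ys"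
    by (simp_all add: ys_def)
  have "(\<Sum>i\<leftarrow>ys. \<beta> $ i) + 1 \<le> n"
    using assms(2) sum.distinct_set_conv_list[OF ys(2), of "\<lambda>i. \<beta> $ i"] ys(1)
    by (simp add: multi_indices_def)
  from flat_antimono[OF this assms(1)] aux[where k = 1 and xs = ys] show ?thesis
    by (simp add: multi_deriv_def ys_def)
qed

text \<open>The bridge between flatness and the multi-index conditions in the sum rule, the vanishing moments
  and the hypothesis on the product of the masks.\<close>

lemma flat_iff_multi_deriv:
  assumes "f \<in> exp_sums UNIV"
  shows "flat n x f \<longleftrightarrow> (\<forall>\<beta> \<in> multi_indices n. multi_deriv \<beta> f x = 0)"
proof
  assume "\<forall>\<beta> \<in> multi_indices n. multi_deriv \<beta> f x = 0"
  with assms show "flat n x f"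
  proof (induction n arbitrary: f)
    case (Suc n)
    have "f x = 0"
      using Suc.prems(2)[rule_format, of 0] by (simp add: multi_deriv_0 multi_indices_def)
    moreover have "flat n x (partial_deriv i f)" for i
    proof (rule Suc.IH[OF partial_deriv_in_exp_sums[OF Suc.prems(1)]], rule ballI)
      fix \<beta> :: "nat ^ 'a" assume "\<beta> \<in> multi_indices n"
      then have "\<beta> + axis i 1 \<in> multi_indices (Suc n)"
        by (simp add: multi_indices_def sum.distrib axis_def)
      then show "multi_deriv \<beta> (partial_deriv i f) x = 0"
        using Suc.prems(2) by (simp add: multi_deriv_partial_deriv[OF Suc.prems(1)])
    qed
    ultimately show ?case by simp
  qed simp
qed (blast intro: flat_imp_multi_deriv_eq_0)

section \<open>Trigonometric polynomials\<close>

lemma real_vec_add: "real_vec (k + l) = real_vec k + real_vec l"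
  and real_vec_diff: "real_vec (k - l) = real_vec k - real_vec l"
  and real_vec_minus: "real_vec (- k) = - real_vec k"
  and real_vec_0 [simp]: "real_vec 0 = 0"
  by (simp_all add: real_vec_def vec_eq_iff)

lemma real_vec_eq_iff: "real_vec k = real_vec l \<longleftrightarrow> k = l"
  by (simp add: real_vec_def vec_eq_iff)

lemma matrix_real_vec: "map_matrix real_of_int A *v real_vec k = real_vec (A *v k)"
  by (simp add: real_vec_def vec_eq_iff matrix_vector_mult_def)

lemma transpose_map_matrix: "transpose (map_matrix f A) = map_matrix f (transpose A)"
  by (simp add: transpose_def vec_eq_iff)

lemma det_map_matrix_of_int: "det (map_matrix real_of_int A) = real_of_int (det A)"
  by (simp add: det_def)

lemma character_integer [simp]: "character (real_vec k) (real_vec l) = 1"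
proof -
  have "real_vec k \<bullet> real_vec l = real_of_int (\<Sum>i\<in>UNIV. k $ i * l $ i)"
    by (simp add: inner_vec_def real_vec_def)
  then show ?thesis
    unfolding character_def exp_eq_1
    by (auto intro!: exI[of _ "\<Sum>i\<in>UNIV. k $ i * l $ i"])
qed

lemma character_periodic: "character (real_vec k) (\<xi> + real_vec l) = character (real_vec k) \<xi>"
  by (simp add: character_add_right)

lemma trig_poly_periodic: "trig_poly t \<Longrightarrow> t (\<xi> + real_vec l) = t \<xi>"
  unfolding trig_poly_def by (auto simp: character_periodic)

lemma trig_poly_exp_sums: "trig_poly t \<Longrightarrow> t \<in> exp_sums UNIV"
  unfolding trig_poly_iff_exp_sums by (erule exp_sums_mono[OF subset_UNIV])

lemma trig_poly_character: "trig_poly (\<lambda>\<xi>. b * character (real_vec k) \<xi>)"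
  unfolding trig_poly_iff_exp_sums by (intro exp_sums_term) simp

lemma trig_poly_const: "trig_poly (\<lambda>\<xi>. b)"
  using trig_poly_character[of b 0] by simp

lemma trig_poly_add: "trig_poly f \<Longrightarrow> trig_poly g \<Longrightarrow> trig_poly (\<lambda>\<xi>. f \<xi> + g \<xi>)"
  and trig_poly_diff: "trig_poly f \<Longrightarrow> trig_poly g \<Longrightarrow> trig_poly (\<lambda>\<xi>. f \<xi> - g \<xi>)"
  and trig_poly_cmult: "trig_poly f \<Longrightarrow> trig_poly (\<lambda>\<xi>. b * f \<xi>)"
  unfolding trig_poly_iff_exp_sums
  by (rule exp_sums_add exp_sums_diff exp_sums_cmult; assumption)+

lemma trig_poly_mult: "trig_poly f \<Longrightarrow> trig_poly g \<Longrightarrow> trig_poly (\<lambda>\<xi>. f \<xi> * g \<xi>)"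
  unfolding trig_poly_iff_exp_sums by (rule exp_sums_mult) (auto simp flip: real_vec_add)

lemma trig_poly_cnj: "trig_poly f \<Longrightarrow> trig_poly (\<lambda>\<xi>. cnj (f \<xi>))"
  unfolding trig_poly_iff_exp_sums by (rule exp_sums_cnj) (auto simp flip: real_vec_minus)

lemma trig_poly_matrix: "trig_poly f \<Longrightarrow> trig_poly (\<lambda>\<xi>. f (map_matrix real_of_int A *v \<xi>))"
  unfolding trig_poly_iff_exp_sums
  by (rule exp_sums_affine[where b = 0, simplified]) (auto simp: transpose_map_matrix matrix_real_vec)

lemma trig_poly_minus: "trig_poly f \<Longrightarrow> trig_poly (\<lambda>\<xi>. f (- \<xi>))"
proof -
  have "map_matrix real_of_int (- mat 1) *v \<xi> = - \<xi>" for \<xi> :: "real ^ 'a"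
  proof -
    have "map_matrix real_of_int (- mat 1) = (- mat 1 :: real ^ 'a ^ 'a)"
      by (simp add: vec_eq_iff mat_def)
    then show ?thesis
      using matrix_vector_mult_diff_rdistrib[of 0 "mat 1" \<xi>] by simp
  qed
  then show "trig_poly f \<Longrightarrow> trig_poly (\<lambda>\<xi>. f (- \<xi>))"
    using trig_poly_matrix[of f "- mat 1"] by simp
qed

section \<open>Digit sets and the characters of the quotient lattice\<close>

text \<open>The point at which the dual digit \<open>l\<close> samples: the characters of the finite group
  \<open>Z^d / M Z^d\<close> are exactly \<open>k \<mapsto> character (real_vec k) (dual_point M l)\<close>, with \<open>l\<close>
  running over a digit set of the transpose.\<close>

definition dual_point :: "int ^ 'd ^ 'd \<Rightarrow> int ^ 'd \<Rightarrow> real ^ 'd" where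
  "dual_point M l = matrix_inv (transpose (map_matrix real_of_int M)) *v real_vec l"

lemma matrix_inv_solves:
  assumes "invertible A"
  shows "A *v (matrix_inv A *v x) = x" and "matrix_inv A *v (A *v x) = x"
proof -
  have "A ** matrix_inv A = mat 1 \<and> matrix_inv A ** A = mat 1"
    unfolding matrix_inv_def by (rule someI_ex) (use assms in \<open>simp add: invertible_def\<close>)
  then show "A *v (matrix_inv A *v x) = x" "matrix_inv A *v (A *v x) = x"
    by (simp_all add: matrix_vector_mul_assoc)
qed

lemma transpose_dual_point:
  assumes "invertible (map_matrix real_of_int M)"
  shows "transpose (map_matrix real_of_int M) *v dual_point M l = real_vec l"
  unfolding dual_point_def using assms by (intro matrix_inv_solves transpose_invertible)

text \<open>The pairing of the two quotient lattices is symmetric, so every fact about it gives a second one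
  with the roles of \<open>M\<close> and its transpose exchanged.\<close>

lemma character_dual_point_swap:
  assumes "invertible (map_matrix real_of_int M)"
  shows "character (real_vec k) (dual_point M l) = character (real_vec l) (dual_point (transpose M) k)"
proof -
  have "map_matrix real_of_int M *v dual_point (transpose M) k = real_vec k"
    using transpose_dual_point[of "transpose M" k] assms
    by (simp flip: transpose_map_matrix add: transpose_invertible)
  then have "real_vec k \<bullet> dual_point M l =
      dual_point (transpose M) k \<bullet> (transpose (map_matrix real_of_int M) *v dual_point M l)"
    by (metis dot_lmul_matrix transpose_matrix_vector transpose_transpose)
  then show ?thesis
    by (simp add: transpose_dual_point[OF assms] character_def inner_commute)
qed

lemma character_lattice_dual_point:
  assumes "invertible (map_matrix real_of_int M)"
  shows "character (real_vec (M *v x)) (dual_point M l) = 1"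
proof -
  have "character (real_vec (M *v x)) (dual_point M l) =
      character (real_vec x) (transpose (map_matrix real_of_int M) *v dual_point M l)"
    by (simp add: character_matrix flip: matrix_real_vec)
  then show ?thesis by (simp add: transpose_dual_point[OF assms])
qed

text \<open>The pairing is nondegenerate: testing against the unit vectors says that the coordinates of
  \<open>M^{-1} k\<close> are integers.\<close>

lemma character_dual_point_trivial_iff:
  assumes "invertible (map_matrix real_of_int M)"
  shows "(\<forall>l. character (real_vec k) (dual_point M l) = 1) \<longleftrightarrow> (\<exists>x. k = M *v x)"
proof
  assume triv: "\<forall>l. character (real_vec k) (dual_point M l) = 1"
  define y where "y = dual_point (transpose M) k"
  have y: "map_matrix real_of_int M *v y = real_vec k"
    using transpose_dual_point[of "transpose M" k] assms
    by (simp flip: transpose_map_matrix add: transpose_invertible y_def)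
  have "\<exists>n :: int. y $ i = of_int n" for i
  proof -
    have "real_vec (axis i 1) = axis i 1"
      by (simp add: real_vec_def vec_eq_iff axis_def)
    then have "character (axis i 1) y = 1"
      using triv[rule_format, of "axis i 1"] character_dual_point_swap[OF assms] by (simp add: y_def)
    then obtain n :: int where "2 * pi * (y $ i) = of_int (2 * n) * pi"
      unfolding character_def exp_eq_1 by (auto simp: inner_axis')
    then have "y $ i = of_int n" by simp
    then show ?thesis ..
  qed
  then obtain x where "\<And>i. y $ i = of_int (x i)" by metis
  then have "y = real_vec (\<chi> i. x i)" by (simp add: real_vec_def vec_eq_iff)
  with y have "real_vec k = real_vec (M *v (\<chi> i. x i))" by (simp add: matrix_real_vec)
  then show "\<exists>x. k = M *v x" by (auto simp: real_vec_eq_iff)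
qed (use assms in \<open>auto simp: character_lattice_dual_point\<close>)

lemma digit_set_unique:
  assumes "digit_set A D" "s \<in> D" "s' \<in> D" "s - s' = A *v l"
  shows "s = s'"
proof -
  have "s - s = A *v 0" by simp
  then show ?thesis
    using assms unfolding digit_set_def by metis
qed

text \<open>Subtracting from a digit \<open>k\<close> the lattice vector with the integer part of \<open>A^{-1} k\<close> as
  coordinates moves it, within its coset, into the bounded image of the unit cube. Distinct digits
  stay distinct, because they lie in distinct cosets.\<close>

lemma finite_digit_set:
  assumes "digit_set A D" "invertible (map_matrix real_of_int A)"
  shows "finite D"
proof -
  define q where "q = (\<lambda>k. \<chi> i. \<lfloor>(matrix_inv (map_matrix real_of_int A) *v real_vec k) $ i\<rfloor>)"
  define r where "r = (\<lambda>k. k - A *v q k)"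
  have "finite {v :: int ^ 'a. \<forall>i. \<bar>v $ i\<bar> \<le> (\<Sum>j\<in>UNIV. \<bar>A $ i $ j\<bar>)}" (is "finite ?B")
  proof -
    have "vec_nth ` ?B \<subseteq> Pi UNIV (\<lambda>i. {- (\<Sum>j\<in>UNIV. \<bar>A $ i $ j\<bar>)..(\<Sum>j\<in>UNIV. \<bar>A $ i $ j\<bar>)})"
      by (auto simp: abs_le_iff, smt (verit))
    moreover have "finite (Pi UNIV (\<lambda>i. {- (\<Sum>j\<in>UNIV. \<bar>A $ i $ j\<bar>)..(\<Sum>j\<in>UNIV. \<bar>A $ i $ j\<bar>)}))"
      using finite_PiE[of "UNIV :: 'a set" "\<lambda>i. {- (\<Sum>j\<in>UNIV. \<bar>A $ i $ j\<bar>)..(\<Sum>j\<in>UNIV. \<bar>A $ i $ j\<bar>)}"]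
      by (simp add: PiE_UNIV_domain)
    ultimately have "finite (vec_nth ` ?B)" by (rule finite_subset)
    then show ?thesis by (rule finite_imageD) (auto simp: inj_on_def vec_eq_iff)
  qed
  moreover have "r ` D \<subseteq> ?B"
  proof clarify
    fix k i
    define y where "y = matrix_inv (map_matrix real_of_int A) *v real_vec k"
    have "real_vec (r k) = map_matrix real_of_int A *v (y - real_vec (q k))"
      using matrix_inv_solves[OF assms(2), of "real_vec k"]
      by (simp add: r_def real_vec_diff y_def matrix_vector_mult_diff_distrib matrix_real_vec)
    then have "real_of_int (r k $ i) = (\<Sum>j\<in>UNIV. real_of_int (A $ i $ j) * (y $ j - \<lfloor>y $ j\<rfloor>))"
      by (simp add: vec_eq_iff real_vec_def matrix_vector_mult_def q_def y_def)
    also have "\<bar>\<dots>\<bar> \<le> (\<Sum>j\<in>UNIV. \<bar>real_of_int (A $ i $ j)\<bar>)"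
    proof (rule order.trans[OF sum_abs sum_mono])
      fix j
      have "\<bar>y $ j - \<lfloor>y $ j\<rfloor>\<bar> \<le> 1" by linarith
      from mult_left_mono[OF this, of "\<bar>real_of_int (A $ i $ j)\<bar>"]
      show "\<bar>real_of_int (A $ i $ j) * (y $ j - \<lfloor>y $ j\<rfloor>)\<bar> \<le> \<bar>real_of_int (A $ i $ j)\<bar>"
        by (simp add: abs_mult)
    qed
    also have "\<dots> = real_of_int (\<Sum>j\<in>UNIV. \<bar>A $ i $ j\<bar>)" by simp
    finally show "\<bar>r k $ i\<bar> \<le> (\<Sum>j\<in>UNIV. \<bar>A $ i $ j\<bar>)" by (simp only: of_int_le_iff flip: of_int_abs)
  qed
  moreover have "inj_on r D"
  proof (rule inj_onI)
    fix k l assume "k \<in> D" "l \<in> D" "r k = r l"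
    then have "k - l = A *v (q k - q l)"
      by (simp add: r_def matrix_vector_mult_diff_distrib algebra_simps)
    with \<open>k \<in> D\<close> \<open>l \<in> D\<close> show "k = l" by (rule digit_set_unique[OF assms(1)])
  qed
  ultimately show ?thesis by (meson finite_imageD finite_subset)
qed

text \<open>The usual argument for character sums: translation by \<open>y\<close> permutes the cosets and multiplies the
  sum by \<open>\<phi> y\<close>.\<close>

lemma sum_multiplicative_digit_set:
  fixes \<phi> :: "int ^ 'd \<Rightarrow> complex"
  assumes "digit_set A D" "finite D"
    and mult: "\<And>x y. \<phi> (x + y) = \<phi> x * \<phi> y" and triv: "\<And>l. \<phi> (A *v l) = 1"
  shows "(\<Sum>s\<in>D. \<phi> s) = (if \<forall>y. \<phi> y = 1 then of_nat (card D) else 0)"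
proof (cases "\<forall>y. \<phi> y = 1")
  case False
  then obtain y where y: "\<phi> y \<noteq> 1" by blast
  have "\<exists>t. t \<in> D \<and> (\<exists>l. s + y - t = A *v l)" for s
    using assms(1) unfolding digit_set_def by blast
  then obtain p where p: "\<And>s. p s \<in> D" "\<And>s. \<exists>l. s + y - p s = A *v l" by metis
  have "inj_on p D"
  proof (rule inj_onI)
    fix s s' assume s: "s \<in> D" "s' \<in> D" "p s = p s'"
    obtain l l' where "s + y - p s = A *v l" "s' + y - p s' = A *v l'" using p(2) by meson
    moreover have "s - s' = (s + y - p s) - (s' + y - p s')" using s(3) by simp
    ultimately have "s - s' = A *v (l - l')"
      by (simp only: matrix_vector_mult_diff_distrib)
    with s(1,2) show "s = s'" using digit_set_unique[OF assms(1)] by blast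
  qed
  moreover have "p ` D \<subseteq> D" using p(1) by blast
  ultimately have bij: "bij_betw p D D"
    by (simp add: bij_betw_def endo_inj_surj assms(2))
  have "\<phi> (p s) = \<phi> s * \<phi> y" for s
  proof -
    obtain l where "s + y - p s = A *v l" using p(2) by blast
    then have "s + y = p s + A *v l" by (simp add: algebra_simps)
    then show ?thesis using mult[of s y] mult[of "p s" "A *v l"] triv by simp
  qed
  then have "(\<Sum>s\<in>D. \<phi> s) = (\<Sum>s\<in>D. \<phi> s) * \<phi> y"
    using sum.reindex_bij_betw[OF bij, of \<phi>] by (simp add: sum_distrib_right)
  with y have "(\<Sum>s\<in>D. \<phi> s) = 0" by simp
  then show ?thesis by (simp only: False if_False)
qed simp

lemma sum_character_dual_point:
  assumes "invertible (map_matrix real_of_int M)" "digit_set (transpose M) D'"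
  shows "(\<Sum>l\<in>D'. character (real_vec k) (dual_point M l)) =
    (if \<exists>x. k = M *v x then of_nat (card D') else 0)"
proof -
  have inv: "invertible (map_matrix real_of_int (transpose M))"
    using transpose_invertible[OF assms(1)] by (simp add: transpose_map_matrix)
  have "character (real_vec k) (dual_point M (transpose M *v l)) = 1" for l
    using character_lattice_dual_point[OF inv, of l k]
    by (simp add: character_dual_point_swap[OF assms(1)])
  then have "(\<Sum>l\<in>D'. character (real_vec k) (dual_point M l)) =
      (if \<forall>l. character (real_vec k) (dual_point M l) = 1 then of_nat (card D') else 0)"
    by (intro sum_multiplicative_digit_set[OF assms(2) finite_digit_set[OF assms(2) inv]])
      (simp_all add: dual_point_def real_vec_add matrix_vector_right_distrib character_add_right)
  then show ?thesis by (simp add: character_dual_point_trivial_iff[OF assms(1)])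
qed

text \<open>Double counting of the full character table: each row except that of the trivial coset sums to
  zero, and so does each column, so the total is the number of columns as well as the number of
  rows.\<close>

lemma card_digit_set_transpose:
  assumes "invertible (map_matrix real_of_int M)" "digit_set M D" "digit_set (transpose M) D'"
  shows "card D = card D'"
proof -
  let ?\<chi> = "\<lambda>k l. character (real_vec k) (dual_point M l)"
  have unique: "\<exists>s0\<in>E. \<forall>s\<in>E. (\<exists>x. s = A *v x) \<longleftrightarrow> s = s0" if E: "digit_set A E"
    for A :: "int ^ 'a ^ 'a" and E
  proof -
    obtain s0 l where s0: "s0 \<in> E" "0 - s0 = A *v l"
      using E unfolding digit_set_def by blast
    then have s0': "s0 = A *v (- l)"
      using matrix_vector_mult_diff_distrib[of A 0 l] by (simp flip: s0(2))
    have "s = s0" if "s \<in> E" "s = A *v x" for s x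
      using digit_set_unique[OF E that(1) s0(1), of "x + l"] that(2) s0'
        matrix_vector_mult_diff_distrib[of A x "- l"] by simp
    then show ?thesis using s0(1) s0' by metis
  qed
  have inv: "invertible (map_matrix real_of_int (transpose M))"
    using transpose_invertible[OF assms(1)] by (simp add: transpose_map_matrix)
  note fin = finite_digit_set[OF assms(2,1)] finite_digit_set[OF assms(3) inv]
  obtain s0 where s0: "s0 \<in> D" "\<forall>s\<in>D. (\<exists>x. s = M *v x) \<longleftrightarrow> s = s0"
    using unique[OF assms(2)] by blast
  obtain t0 where t0: "t0 \<in> D'" "\<forall>s\<in>D'. (\<exists>x. s = transpose M *v x) \<longleftrightarrow> s = t0"
    using unique[OF assms(3)] by blast
  have "(\<Sum>s\<in>D. \<Sum>l\<in>D'. ?\<chi> s l) = (\<Sum>s\<in>D. if s = s0 then of_nat (card D') else 0)"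
    using s0(2) by (intro sum.cong) (simp_all add: sum_character_dual_point[OF assms(1,3)])
  moreover have "(\<Sum>l\<in>D'. \<Sum>s\<in>D. ?\<chi> s l) = (\<Sum>l\<in>D'. if l = t0 then of_nat (card D) else 0)"
    using t0(2) sum_character_dual_point[OF inv, of D] assms(2)
    by (intro sum.cong) (simp_all add: character_dual_point_swap[OF assms(1)])
  ultimately have "of_nat (card D') = (of_nat (card D) :: complex)"
    using s0(1) t0(1) fin sum.swap[of ?\<chi> D' D] by simp
  then show ?thesis by simp
qed

section \<open>Polyphase components\<close>

locale dilation_digits =
  fixes M :: "int ^ 'd ^ 'd" and s :: "nat \<Rightarrow> int ^ 'd" and D' :: "(int ^ 'd) set"
  assumes inj_digits: "inj_on s {..<num_digits M}"
    and digits: "digit_set M (s ` {..<num_digits M})"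
    and dual_digits: "digit_set (transpose M) D'"
begin

abbreviation MT :: "real ^ 'd ^ 'd" where "MT \<equiv> transpose (map_matrix real_of_int M)"

abbreviation m :: nat where "m \<equiv> num_digits M"

abbreviation rm :: complex where "rm \<equiv> of_real (sqrt (real m))"

lemma num_digits_pos: "m > 0"
proof -
  have "s ` {..<m} \<noteq> {}" using digits unfolding digit_set_def by blast
  then show ?thesis by auto
qed

lemma rm_square: "rm * rm = of_nat m"
  by (simp flip: of_real_mult)

lemma rm_nonzero: "rm \<noteq> 0"
  using num_digits_pos by simp

lemma invertible_dilation: "invertible (map_matrix real_of_int M)"
  using num_digits_pos by (simp add: invertible_det_nz det_map_matrix_of_int num_digits_def)

lemma card_dual_digits: "card D' = m"
  using card_digit_set_transpose[OF invertible_dilation digits dual_digits] card_image[OF inj_digits]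
  by simp

lemma digit_index: "\<exists>j<m. \<exists>l. k = s j + M *v l"
proof -
  obtain j l where "j < m" "k - s j = M *v l"
    using digits unfolding digit_set_def by blast
  then show ?thesis by (intro exI[of _ j] conjI exI[of _ l]) (simp_all add: algebra_simps)
qed

lemma digit_index_unique: "j < m \<Longrightarrow> k < m \<Longrightarrow> s j - s k = M *v l \<Longrightarrow> j = k"
  using digit_set_unique[OF digits, of "s j" "s k" l] inj_digits by (auto simp: inj_on_def)

lemma sum_character_dual_digits:
  assumes "j < m" "k < m"
  shows "(\<Sum>l\<in>D'. character (real_vec (s j - s k)) (dual_point M l)) = (if j = k then of_nat m else 0)"
proof -
  have "(\<exists>x. s j - s k = M *v x) \<longleftrightarrow> j = k"
    using digit_index_unique[OF assms] by (metis diff_self matrix_vector_mult_0_right)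
  then show ?thesis
    by (simp add: sum_character_dual_point[OF invertible_dilation dual_digits] card_dual_digits)
qed

text \<open>Sorting the terms of \<open>t\<close> by the coset of their frequency.\<close>

lemma polyphase_exists:
  assumes "trig_poly t"
  shows "\<exists>\<tau>. polyphase_components M s t \<tau>"
proof -
  obtain K h where K: "finite K" "t = (\<lambda>\<xi>. \<Sum>k\<in>K. h k * character (real_vec k) \<xi>)"
    using assms unfolding trig_poly_def by blast
  obtain J L where J: "\<And>k. J k < m" and L: "\<And>k. k = s (J k) + M *v L k"
    using digit_index by metis
  define \<tau> where "\<tau> j \<omega> = (\<Sum>k\<in>K. (if J k = j then rm * h k else 0) * character (real_vec (L k)) \<omega>)" for j \<omega>
  have "trig_poly (\<tau> j)" for j
    unfolding trig_poly_iff_exp_sums \<tau>_def by (intro exp_sums_sum exp_sums_term) simp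
  moreover have "t \<xi> = 1 / rm * (\<Sum>j<m. character (real_vec (s j)) \<xi> * \<tau> j (MT *v \<xi>))" for \<xi>
  proof -
    have char: "character (real_vec (s (J k))) \<xi> * character (real_vec (L k)) (MT *v \<xi>) =
        character (real_vec k) \<xi>" for k
      by (subst (3) L) (simp add: character_matrix real_vec_add character_add_left matrix_real_vec)
    have "(\<Sum>j<m. character (real_vec (s j)) \<xi> * \<tau> j (MT *v \<xi>)) =
        (\<Sum>k\<in>K. \<Sum>j<m. if J k = j then
          rm * h k * (character (real_vec (s j)) \<xi> * character (real_vec (L k)) (MT *v \<xi>)) else 0)"
      unfolding \<tau>_def sum_distrib_left by (subst sum.swap) (intro sum.cong refl, simp)
    also have "\<dots> = rm * t \<xi>"
      by (simp add: J char K(2) sum_distrib_left mult_ac)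
    finally show ?thesis using rm_nonzero by simp
  qed
  ultimately show ?thesis unfolding polyphase_components_def by blast
qed

text \<open>The component of a coset is recovered by averaging the values of \<open>t\<close> over the dual points against
  the conjugate characters; the normalisation is right because there are as many dual digits as
  digits. This formula carries both uniqueness and the effect of the sum rule.\<close>

lemma polyphase_inversion:
  assumes "polyphase_components M s t \<tau>" "j < m"
  shows "\<tau> j (MT *v \<xi>) = 1 / rm *
    (\<Sum>l\<in>D'. t (\<xi> + dual_point M l) * character (- real_vec (s j)) (\<xi> + dual_point M l))"
proof -
  have t: "\<And>\<eta>. t \<eta> = 1 / rm * (\<Sum>k<m. character (real_vec (s k)) \<eta> * \<tau> k (MT *v \<eta>))"
    and per: "\<And>k \<xi> l. k < m \<Longrightarrow> \<tau> k (\<xi> + real_vec l) = \<tau> k \<xi>"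
    using assms(1) trig_poly_periodic unfolding polyphase_components_def by blast+
  have *: "t (\<xi> + dual_point M l) * character (- real_vec (s j)) (\<xi> + dual_point M l) =
     1 / rm * (\<Sum>k<m. character (real_vec (s k - s j)) \<xi> * \<tau> k (MT *v \<xi>) *
         character (real_vec (s k - s j)) (dual_point M l))" for l
    unfolding t
    by (simp add: matrix_vector_right_distrib transpose_dual_point[OF invertible_dilation] per
        sum_distrib_left sum_distrib_right mult_ac character_add_right
        character_add_left[of "real_vec (s _)" "- real_vec (s j)", simplified] real_vec_diff)
  have "(\<Sum>l\<in>D'. t (\<xi> + dual_point M l) * character (- real_vec (s j)) (\<xi> + dual_point M l)) =
     1 / rm * (\<Sum>k<m. character (real_vec (s k - s j)) \<xi> * \<tau> k (MT *v \<xi>) *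
         (\<Sum>l\<in>D'. character (real_vec (s k - s j)) (dual_point M l)))"
    unfolding * sum_distrib_left by (subst sum.swap) simp
  also have "\<dots> = 1 / rm * (\<Sum>k<m. if k = j then character (real_vec (s k - s j)) \<xi> * \<tau> k (MT *v \<xi>) * of_nat m else 0)"
    using assms(2) by (intro arg_cong2[where f = "(*)"] sum.cong refl) (simp add: sum_character_dual_digits)
  also have "\<dots> = 1 / rm * \<tau> j (MT *v \<xi>) * of_nat m"
    using assms(2) by simp
  also have "\<dots> = rm * \<tau> j (MT *v \<xi>)"
    using rm_nonzero unfolding rm_square[symmetric] by simp
  finally show ?thesis using rm_nonzero by simp
qed

lemma polyphase_unique:
  assumes "polyphase_components M s t \<tau>" "polyphase_components M s t \<tau>'" "j < m"
  shows "\<tau> j = \<tau>' j"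
proof
  fix \<omega>
  define \<xi> where "\<xi> = matrix_inv MT *v \<omega>"
  have "\<omega> = MT *v \<xi>"
    unfolding \<xi>_def by (simp add: matrix_inv_solves transpose_invertible invertible_dilation)
  then show "\<tau> j \<omega> = \<tau>' j \<omega>"
    using polyphase_inversion[OF assms(1,3), of \<xi>] polyphase_inversion[OF assms(2,3), of \<xi>] by simp
qed

end

context dilation_digits
begin

lemma polyphase_linear:
  assumes "polyphase_components M s t \<tau>" "polyphase_components M s t' \<tau>'"
  shows "polyphase_components M s (\<lambda>\<xi>. a * t \<xi> + b * t' \<xi>) (\<lambda>k \<omega>. a * \<tau> k \<omega> + b * \<tau>' k \<omega>)"
  unfolding polyphase_components_def
proof (intro conjI allI impI)
  fix k assume "k < m"
  then show "trig_poly (\<lambda>\<omega>. a * \<tau> k \<omega> + b * \<tau>' k \<omega>)"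
    using assms unfolding polyphase_components_def by (intro trig_poly_add trig_poly_cmult) auto
next
  fix \<xi>
  have t: "t \<xi> = 1 / rm * (\<Sum>k<m. character (real_vec (s k)) \<xi> * \<tau> k (MT *v \<xi>))"
    "t' \<xi> = 1 / rm * (\<Sum>k<m. character (real_vec (s k)) \<xi> * \<tau>' k (MT *v \<xi>))"
    using assms unfolding polyphase_components_def by blast+
  show "a * t \<xi> + b * t' \<xi> =
      1 / rm * (\<Sum>k<m. character (real_vec (s k)) \<xi> * (a * \<tau> k (MT *v \<xi>) + b * \<tau>' k (MT *v \<xi>)))"
    unfolding t by (simp add: ring_distribs sum.distrib sum_distrib_left mult_ac)
qed

text \<open>What the sum rule means for the polyphase components: in the inversion formula only the term at the
  dual digit \<open>0\<close> survives to order \<open>n\<close>, so that up to order \<open>n\<close> every component is the same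
  multiple of the mask itself, up to a character.\<close>

lemma polyphase_flat:
  assumes "trig_poly t" "sum_rule M D' n t" "0 \<in> D'" "polyphase_components M s t \<tau>" "j < m"
  shows "flat n 0 (\<lambda>\<xi>. \<tau> j (MT *v \<xi>) - 1 / rm * t \<xi> * character (- real_vec (s j)) \<xi>)"
proof -
  have inv: "invertible MT" by (intro transpose_invertible invertible_dilation)
  have fin: "finite D'"
    using finite_digit_set[OF dual_digits] inv by (simp add: transpose_map_matrix)
  have E: "(\<lambda>\<xi>. t (\<xi> + dual_point M l)) \<in> exp_sums UNIV" for l
    using exp_sums_affine[of UNIV "mat 1" UNIV t "dual_point M l"] trig_poly_exp_sums[OF assms(1)]
    by simp
  have C: "(\<lambda>\<xi>. 1 / rm * character (- real_vec (s j)) (\<xi> + dual_point M l)) \<in> exp_sums UNIV" for l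
    using exp_sums_affine[of UNIV "mat 1" UNIV "character (- real_vec (s j))" "dual_point M l"]
    by (intro exp_sums_cmult) (simp add: exp_sums_character)
  have F: "flat n 0 (\<lambda>\<xi>. t (\<xi> + dual_point M l))" if l: "l \<in> D' - {0}" for l
  proof -
    \<comment> \<open>The sum rule speaks about the derivatives of the dilated mask at \<open>l\<close>; an affine change of
      variables carries them to \<open>0\<close>.\<close>
    have E': "(\<lambda>\<xi>. t (matrix_inv MT *v \<xi>)) \<in> exp_sums UNIV"
      using exp_sums_affine[of UNIV "matrix_inv MT" UNIV t 0] trig_poly_exp_sums[OF assms(1)] by simp
    have "flat n (real_vec l) (\<lambda>\<xi>. t (matrix_inv MT *v \<xi>))"
      unfolding flat_iff_multi_deriv[OF E'] using assms(2) l by (auto simp: sum_rule_def)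
    then have "flat n 0 (\<lambda>\<xi>. t (matrix_inv MT *v (MT *v \<xi> + real_vec l)))"
      using flat_affine[OF E', of n MT 0 "real_vec l"] by simp
    then show ?thesis
      by (simp add: matrix_vector_right_distrib matrix_inv_solves[OF inv] dual_point_def)
  qed
  have "\<tau> j (MT *v \<xi>) - 1 / rm * t \<xi> * character (- real_vec (s j)) \<xi> =
    (\<Sum>l\<in>D' - {0}. t (\<xi> + dual_point M l) * (1 / rm * character (- real_vec (s j)) (\<xi> + dual_point M l)))"
    for \<xi>
  proof -
    have "dual_point M 0 = 0" by (simp add: dual_point_def)
    then show ?thesis
      unfolding polyphase_inversion[OF assms(4,5)] sum.remove[OF fin assms(3)]
      by (simp add: ring_distribs sum_distrib_left sum_divide_distrib mult_ac)
  qed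
  then show ?thesis
    using F by (simp only:) (intro flat_sum flat_mult exp_sums_mult E C; simp)
qed

section \<open>Wavelet masks attached to the digits\<close>

definition digit_mask :: "nat \<Rightarrow> real ^ 'd \<Rightarrow> complex" where
  "digit_mask j \<xi> = 1 / rm * character (real_vec (s j)) \<xi>"

text \<open>With the masks \<open>digit_mask\<close> the lower block of one polyphase matrix is the identity, so that the
  mixed extension principle leaves no choice for the other: it is the identity minus the rank one
  contribution of the refinable masks. These are the masks with those polyphase components.\<close>

definition dual_digit_mask ::
    "(nat \<Rightarrow> real ^ 'd \<Rightarrow> complex) \<Rightarrow> (real ^ 'd \<Rightarrow> complex) \<Rightarrow> nat \<Rightarrow> real ^ 'd \<Rightarrow> complex" where
  "dual_digit_mask \<tau> t' j \<xi> = digit_mask j \<xi> - cnj (\<tau> j (MT *v \<xi>)) * t' \<xi>"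

lemma trig_poly_digit_mask: "trig_poly (digit_mask j)"
  unfolding digit_mask_def[abs_def] by (rule trig_poly_character)

lemma trig_poly_dual_digit_mask:
  "trig_poly (\<tau> j) \<Longrightarrow> trig_poly t' \<Longrightarrow> trig_poly (dual_digit_mask \<tau> t' j)"
  unfolding dual_digit_mask_def[abs_def] transpose_map_matrix
  by (intro trig_poly_diff trig_poly_mult trig_poly_cnj trig_poly_matrix) (simp_all add: trig_poly_digit_mask)

text \<open>To order \<open>n\<close>, the component \<open>\<tau> j\<close> may be replaced by \<open>t\<close> times a character; this leaves
  the digit mask times the conjugate of \<open>1 - t * cnj t'\<close>.\<close>

lemma flat_dual_digit_mask:
  assumes "trig_poly t" "sum_rule M D' n t" "0 \<in> D'" "polyphase_components M s t \<tau>" "j < m"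
    and "trig_poly t'" and "flat n 0 (\<lambda>\<xi>. 1 - t \<xi> * cnj (t' \<xi>))"
  shows "flat n 0 (dual_digit_mask \<tau> t' j)"
proof -
  let ?d = "\<lambda>\<xi>. \<tau> j (MT *v \<xi>) - 1 / rm * t \<xi> * character (- real_vec (s j)) \<xi>"
  let ?e = "\<lambda>\<xi>. 1 - t \<xi> * cnj (t' \<xi>)"
  have "trig_poly (\<tau> j)" using assms(4,5) unfolding polyphase_components_def by blast
  then have "trig_poly (\<lambda>\<xi>. \<tau> j (MT *v \<xi>))"
    unfolding transpose_map_matrix by (rule trig_poly_matrix)
  moreover have "trig_poly (\<lambda>\<xi>. 1 / rm * t \<xi> * character (- real_vec (s j)) \<xi>)"
    using trig_poly_mult[OF trig_poly_cmult[OF assms(1), of "1 / rm"] trig_poly_character[of 1 "- s j"]]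
    by (simp add: real_vec_minus)
  ultimately have "trig_poly ?d" by (rule trig_poly_diff)
  have "trig_poly ?e"
    by (intro trig_poly_diff trig_poly_mult trig_poly_cnj trig_poly_const assms(1,6))
  note E = trig_poly_exp_sums[OF \<open>trig_poly ?d\<close>] trig_poly_exp_sums[OF \<open>trig_poly ?e\<close>]
    trig_poly_exp_sums[OF assms(6)] trig_poly_exp_sums[OF trig_poly_digit_mask]
  have "flat n 0 (\<lambda>\<xi>. cnj (?e \<xi>) * digit_mask j \<xi> + cnj (?d \<xi>) * (- 1 * t' \<xi>))"
    by (intro flat_add flat_mult flat_cnj exp_sums_mult exp_sums_cnj exp_sums_cmult E
        polyphase_flat[OF assms(1-5)] assms(7) UNIV_I)
  moreover have "dual_digit_mask \<tau> t' j =
      (\<lambda>\<xi>. cnj (?e \<xi>) * digit_mask j \<xi> + cnj (?d \<xi>) * (- 1 * t' \<xi>))"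
    by (simp add: fun_eq_iff dual_digit_mask_def digit_mask_def cnj_character algebra_simps diff_divide_distrib)
  ultimately show ?thesis by simp
qed

lemma polyphase_digit_mask:
  assumes "j < m"
  shows "polyphase_components M s (digit_mask j) (\<lambda>k \<omega>. if j = k then 1 else 0)"
  using assms unfolding polyphase_components_def digit_mask_def
  by (auto simp: trig_poly_const if_distrib cong: if_cong)

lemma polyphase_dual_digit_mask:
  assumes "polyphase_components M s t \<tau>" "polyphase_components M s t' \<tau>'" "j < m"
  shows "polyphase_components M s (dual_digit_mask \<tau> t' j)
    (\<lambda>k \<omega>. (if j = k then 1 else 0) - cnj (\<tau> j \<omega>) * \<tau>' k \<omega>)"
  unfolding polyphase_components_def
proof (intro conjI allI impI)
  fix k assume "k < m"
  then show "trig_poly (\<lambda>\<omega>. (if j = k then 1 else 0) - cnj (\<tau> j \<omega>) * \<tau>' k \<omega>)"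
    using assms unfolding polyphase_components_def
    by (intro trig_poly_diff trig_poly_mult trig_poly_cnj trig_poly_const) auto
next
  fix \<xi>
  have t': "t' \<xi> = 1 / rm * (\<Sum>k<m. character (real_vec (s k)) \<xi> * \<tau>' k (MT *v \<xi>))"
    using assms(2) unfolding polyphase_components_def by blast
  have e: "digit_mask j \<xi> = 1 / rm * (\<Sum>k<m. character (real_vec (s k)) \<xi> * (if j = k then 1 else 0))"
    using polyphase_digit_mask[OF assms(3)] unfolding polyphase_components_def by blast
  show "dual_digit_mask \<tau> t' j \<xi> = 1 / rm * (\<Sum>k<m. character (real_vec (s k)) \<xi> *
      ((if j = k then 1 else 0) - cnj (\<tau> j (MT *v \<xi>)) * \<tau>' k (MT *v \<xi>)))"
    unfolding dual_digit_mask_def t' e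
    by (simp add: right_diff_distrib sum_subtractf sum_distrib_left mult_ac del: mult_delta_right)
qed

end

section \<open>Reflection of the digits and symmetry\<close>

text \<open>A mask that is symmetric about \<open>\<kappa> / 2\<close> has its frequencies permuted by \<open>k \<mapsto> \<kappa> - k\<close>. This
  reflection acts on the cosets of \<open>M Z^d\<close>, hence as an involution \<open>\<sigma>\<close> on the digit indices; \<open>L\<close>
  records the lattice vectors by which reflected digits miss the chosen representatives.\<close>

locale reflected_digits = dilation_digits M s D'
  for M :: "int ^ 'd ^ 'd" and s :: "nat \<Rightarrow> int ^ 'd" and D' :: "(int ^ 'd) set" +
  fixes \<kappa> :: "int ^ 'd" and \<sigma> :: "nat \<Rightarrow> nat" and L :: "nat \<Rightarrow> int ^ 'd"
  assumes \<sigma>_less: "\<sigma> j < m"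
    and reflect_digit: "\<kappa> - s j = s (\<sigma> j) + M *v L j"
begin

lemma \<sigma>_\<sigma>: "j < m \<Longrightarrow> \<sigma> (\<sigma> j) = j"
proof -
  assume "j < m"
  have "s (\<sigma> (\<sigma> j)) - s j = M *v (L j - L (\<sigma> j))"
    using reflect_digit[of j] reflect_digit[of "\<sigma> j"]
    by (simp add: matrix_vector_mult_diff_distrib algebra_simps)
  then show "\<sigma> (\<sigma> j) = j" using digit_index_unique[OF \<sigma>_less \<open>j < m\<close>] by blast
qed

lemma bij_\<sigma>: "bij_betw \<sigma> {..<m} {..<m}"
  by (rule bij_betwI[where g = \<sigma>]) (auto simp: \<sigma>_less \<sigma>_\<sigma>)

text \<open>The reflected terms of \<open>t\<close> form a second polyphase decomposition of \<open>t\<close>, which must agree with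
  the given one.\<close>

lemma polyphase_reflect:
  assumes "polyphase_components M s t \<tau>" and "\<And>\<xi>. t \<xi> = character (real_vec \<kappa>) \<xi> * t (- \<xi>)"
    and "j < m"
  shows "\<tau> (\<sigma> j) \<omega> = character (real_vec (L j)) \<omega> * \<tau> j (- \<omega>)"
proof -
  define \<tau>' where "\<tau>' k \<omega> = character (real_vec (L (\<sigma> k))) \<omega> * \<tau> (\<sigma> k) (- \<omega>)" for k \<omega>
  have t: "\<And>\<eta>. t \<eta> = 1 / rm * (\<Sum>k<m. character (real_vec (s k)) \<eta> * \<tau> k (MT *v \<eta>))"
    using assms(1) unfolding polyphase_components_def by blast
  have "t \<xi> = 1 / rm * (\<Sum>k<m. character (real_vec (s k)) \<xi> * \<tau>' k (MT *v \<xi>))" for \<xi>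
  proof -
    have digit: "character (real_vec \<kappa>) \<xi> * character (real_vec (s k)) (- \<xi>) =
        character (real_vec (s (\<sigma> k))) \<xi> * character (real_vec (L k)) (MT *v \<xi>)" for k
    proof -
      have "character (real_vec \<kappa>) \<xi> * character (real_vec (s k)) (- \<xi>) = character (real_vec (\<kappa> - s k)) \<xi>"
        by (simp add: character_minus_right real_vec_diff flip: character_add_left)
      then show ?thesis
        by (simp add: reflect_digit real_vec_add character_add_left character_matrix matrix_real_vec)
    qed
    have "MT *v (- \<xi>) = - (MT *v \<xi>)"
      using matrix_vector_mult_diff_distrib[of MT 0 \<xi>] by simp
    then have "t \<xi> = 1 / rm * (\<Sum>k<m. character (real_vec \<kappa>) \<xi> * character (real_vec (s k)) (- \<xi>) *
        \<tau> k (- (MT *v \<xi>)))"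
      unfolding assms(2)[of \<xi>] t[of "- \<xi>"] by (simp add: sum_distrib_left mult_ac)
    also have "(\<Sum>k<m. character (real_vec \<kappa>) \<xi> * character (real_vec (s k)) (- \<xi>) * \<tau> k (- (MT *v \<xi>))) =
        (\<Sum>k<m. character (real_vec (s k)) \<xi> * \<tau>' k (MT *v \<xi>))"
      unfolding digit sum.reindex_bij_betw[OF bij_\<sigma>, symmetric,
          of "\<lambda>k. character (real_vec (s k)) \<xi> * \<tau>' k (MT *v \<xi>)"]
      by (intro sum.cong) (simp_all add: \<tau>'_def \<sigma>_\<sigma>)
    finally show ?thesis .
  qed
  moreover have "trig_poly (\<tau>' k)" for k
    using assms(1) \<sigma>_less unfolding \<tau>'_def polyphase_components_def
    using trig_poly_character[of 1] by (intro trig_poly_mult trig_poly_minus) auto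
  ultimately have "polyphase_components M s t \<tau>'"
    unfolding polyphase_components_def by blast
  from polyphase_unique[OF assms(1) this \<sigma>_less] show ?thesis
    by (simp add: \<tau>'_def \<sigma>_\<sigma> assms(3))
qed

text \<open>Reflection about the midpoint of \<open>s j\<close> and \<open>s (\<sigma> j)\<close> exchanges the masks of the two digits.\<close>

definition reflects :: "(nat \<Rightarrow> real ^ 'd \<Rightarrow> complex) \<Rightarrow> bool" where
  "reflects g \<longleftrightarrow>
    (\<forall>j<m. \<forall>\<xi>. g (\<sigma> j) \<xi> = character (real_vec (s j + s (\<sigma> j))) \<xi> * g j (- \<xi>))"

lemma digit_mask_reflects: "reflects digit_mask"
proof -
  have "character (real_vec (s j + s (\<sigma> j))) \<xi> * character (real_vec (s j)) (- \<xi>) =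
      character (real_vec (s (\<sigma> j))) \<xi>" for j \<xi>
    by (simp add: character_minus_right real_vec_add flip: character_add_left)
  then show ?thesis
    unfolding reflects_def digit_mask_def by (simp add: mult.left_commute)
qed

lemma dual_digit_mask_reflects:
  assumes "polyphase_components M s t \<tau>"
    and "\<And>\<xi>. t \<xi> = character (real_vec \<kappa>) \<xi> * t (- \<xi>)"
    and "\<And>\<xi>. t' \<xi> = character (real_vec \<kappa>) \<xi> * t' (- \<xi>)"
  shows "reflects (dual_digit_mask \<tau> t')"
  unfolding reflects_def
proof (intro allI impI)
  fix j \<xi> assume j: "j < m"
  let ?p = "character (real_vec (s j + s (\<sigma> j))) \<xi>"
  have "cnj (character (real_vec (L j)) (MT *v \<xi>)) * character (real_vec \<kappa>) \<xi> =
      character (real_vec (\<kappa> - M *v L j)) \<xi>"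
    by (simp add: cnj_character character_matrix flip: character_add_left real_vec_minus)
       (simp add: real_vec_diff matrix_real_vec real_vec_minus character_add_left flip: character_add_left)
  also have "\<kappa> - M *v L j = s j + s (\<sigma> j)"
    using reflect_digit[of j] by (simp add: algebra_simps)
  finally have p: "cnj (character (real_vec (L j)) (MT *v \<xi>)) * character (real_vec \<kappa>) \<xi> = ?p" .
  have neg: "MT *v (- \<xi>) = - (MT *v \<xi>)"
    using matrix_vector_mult_diff_distrib[of MT 0 \<xi>] by simp
  have "dual_digit_mask \<tau> t' (\<sigma> j) \<xi> = ?p * digit_mask j (- \<xi>) -
      cnj (character (real_vec (L j)) (MT *v \<xi>) * \<tau> j (- (MT *v \<xi>))) *
      (character (real_vec \<kappa>) \<xi> * t' (- \<xi>))"
    using digit_mask_reflects j polyphase_reflect[OF assms(1,2) j] assms(3)[of \<xi>]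
    by (simp add: dual_digit_mask_def reflects_def)
  also have "\<dots> = ?p * dual_digit_mask \<tau> t' j (- \<xi>)"
    unfolding p[symmetric] dual_digit_mask_def neg by (simp add: algebra_simps)
  finally show "dual_digit_mask \<tau> t' (\<sigma> j) \<xi> = ?p * dual_digit_mask \<tau> t' j (- \<xi>)" .
qed

text \<open>Coefficients of the real orthogonal change of basis that is trivial on the fixed digits of \<open>\<sigma>\<close>
  and rotates each pair of exchanged digits by 45 degrees. The comparison of the indices decides
  which member of the pair gets the sum and which one the difference.\<close>

definition own_weight :: "nat \<Rightarrow> complex" where
  "own_weight j = (if \<sigma> j = j then 1 else of_real (sqrt (1 / 2)))"

definition mirror_weight :: "nat \<Rightarrow> complex" where
  "mirror_weight j = (if \<sigma> j = j then 0 else if j < \<sigma> j then of_real (sqrt (1 / 2))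
    else - of_real (sqrt (1 / 2)))"

definition mix :: "(nat \<Rightarrow> complex) \<Rightarrow> nat \<Rightarrow> complex" where
  "mix x j = own_weight j * x j + mirror_weight j * x (\<sigma> j)"

lemma cnj_mix: "cnj (mix x j) = mix (\<lambda>k. cnj (x k)) j"
  by (simp add: mix_def own_weight_def mirror_weight_def)

text \<open>The columns of a real orthogonal matrix are orthonormal; \<open>y\<close> is arbitrary, so that one side of the
  extension principle can be a unit vector and the other an unknown row.\<close>

lemma mix_orthogonal:
  assumes "p < m"
  shows "(\<Sum>j<m. mix (\<lambda>k. if k = p then 1 else 0) j * mix y j) = y p"
proof -
  have "\<sigma> j = p \<longleftrightarrow> j = \<sigma> p" if "j < m" for j
    using that assms \<sigma>_\<sigma> by metis
  then have "(\<Sum>j<m. mix (\<lambda>k. if k = p then 1 else 0) j * mix y j) =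
      (\<Sum>j<m. (if j = p then own_weight j * mix y j else 0) +
        (if j = \<sigma> p then mirror_weight j * mix y j else 0))"
    by (intro sum.cong) (simp_all add: mix_def[of "\<lambda>k. if k = p then 1 else 0"] ring_distribs)
  also have "\<dots> = own_weight p * mix y p + mirror_weight (\<sigma> p) * mix y (\<sigma> p)"
    using assms \<sigma>_less by (simp add: sum.distrib)
  also have "\<dots> = y p"
  proof (cases "\<sigma> p = p")
    case False
    define r where "r = complex_of_real (sqrt (1 / 2))"
    have "r * r = 1 / 2" by (simp add: r_def flip: of_real_mult)
    then have "r * (r * y p) = y p / 2" by (simp flip: mult.assoc)
    moreover have "own_weight p = r" "own_weight (\<sigma> p) = r"
      and "mirror_weight p = (if p < \<sigma> p then r else - r)"
      and "mirror_weight (\<sigma> p) = (if p < \<sigma> p then - r else r)"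
      using False \<sigma>_\<sigma>[OF assms] by (auto simp: own_weight_def mirror_weight_def r_def)
    ultimately show ?thesis
      using \<sigma>_\<sigma>[OF assms] by (auto simp: mix_def algebra_simps)
  qed (simp add: mix_def own_weight_def mirror_weight_def)
  finally show ?thesis .
qed

text \<open>A fixed digit has a mask that is symmetric about the digit; sums and differences of two exchanged
  masks are symmetric and antisymmetric about the midpoint.\<close>

lemma mix_symmetric:
  assumes "reflects g" "j < m"
  shows "\<exists>p\<in>half_lattice. symmetric_wrt p (\<lambda>\<xi>. mix (\<lambda>k. g k \<xi>) j) \<or>
    antisymmetric_wrt p (\<lambda>\<xi>. mix (\<lambda>k. g k \<xi>) j)"
proof
  define p where "p = (1 / 2) *\<^sub>R real_vec (s j + s (\<sigma> j))"
  show "p \<in> half_lattice" unfolding half_lattice_def p_def by blast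
  have p2: "2 *\<^sub>R p = real_vec (s j + s (\<sigma> j))" by (simp add: p_def)
  have g1: "character (2 *\<^sub>R p) \<xi> * g j (- \<xi>) = g (\<sigma> j) \<xi>" for \<xi>
    using assms unfolding reflects_def p2 by simp
  have g2: "character (2 *\<^sub>R p) \<xi> * g (\<sigma> j) (- \<xi>) = g j \<xi>" for \<xi>
    using assms(1) \<sigma>_less[of j] unfolding reflects_def p2 by (metis \<sigma>_\<sigma> add.commute assms(2))
  have "character (2 *\<^sub>R p) \<xi> * mix (\<lambda>k. g k (- \<xi>)) j =
      own_weight j * g (\<sigma> j) \<xi> + mirror_weight j * g j \<xi>" for \<xi>
    unfolding mix_def g1[symmetric, of \<xi>] g2[symmetric, of \<xi>] by (simp add: ring_distribs mult_ac)
  then show "symmetric_wrt p (\<lambda>\<xi>. mix (\<lambda>k. g k \<xi>) j) \<or>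
    antisymmetric_wrt p (\<lambda>\<xi>. mix (\<lambda>k. g k \<xi>) j)"
    unfolding symmetric_wrt_def antisymmetric_wrt_def
    by (auto simp: mix_def own_weight_def mirror_weight_def)
qed

lemma polyphase_mix:
  assumes "\<And>j. j < m \<Longrightarrow> polyphase_components M s (g j) (\<gamma> j)" "j < m"
  shows "polyphase_components M s (\<lambda>\<xi>. mix (\<lambda>i. g i \<xi>) j) (\<lambda>k \<omega>. mix (\<lambda>i. \<gamma> i k \<omega>) j)"
  unfolding mix_def by (intro polyphase_linear assms \<sigma>_less)

lemma trig_poly_mix:
  assumes "\<And>j. j < m \<Longrightarrow> trig_poly (g j)" "j < m"
  shows "trig_poly (\<lambda>\<xi>. mix (\<lambda>i. g i \<xi>) j)"
  unfolding mix_def by (intro trig_poly_add trig_poly_cmult assms \<sigma>_less)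

lemma flat_mix:
  assumes "\<And>j. j < m \<Longrightarrow> trig_poly (g j)" "\<And>j. j < m \<Longrightarrow> flat n x (g j)" "j < m"
  shows "flat n x (\<lambda>\<xi>. mix (\<lambda>i. g i \<xi>) j)"
proof -
  have "flat n x (\<lambda>\<xi>. g i \<xi> * b)" if "i < m" for i b
    by (intro flat_mult exp_sums_const trig_poly_exp_sums assms(1,2) that UNIV_I)
  then show ?thesis
    unfolding mix_def
    by (intro flat_add exp_sums_cmult trig_poly_exp_sums assms(1,3) \<sigma>_less)
      (simp_all add: mult.commute \<sigma>_less assms(3))
qed

end

theorem theorem19:
  fixes M :: "int ^ 'd ^ 'd"
    and s :: "nat \<Rightarrow> int ^ 'd"
    and D' :: "(int ^ 'd) set"
    and c :: "real ^ 'd"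
    and n :: nat
    and m0 m0' :: "real ^ 'd \<Rightarrow> complex"
  assumes "matrix_dilation M"
    and "inj_on s {..<num_digits M}" and "digit_set M (s ` {..<num_digits M})"
    and "digit_set (transpose M) D'" and "0 \<in> D'"
    and "c \<in> half_lattice"
    and "n \<ge> 1"
    and "refinable_mask m0" and "refinable_mask m0'"
    and "symmetric_wrt c m0" and "symmetric_wrt c m0'"
    and "sum_rule M D' n m0"
    and "\<forall>\<beta> \<in> multi_indices n. multi_deriv \<beta> (\<lambda>\<xi>. 1 - m0 \<xi> * cnj (m0' \<xi>)) 0 = 0"
  shows "\<exists>w w'. wavelet_masks M s m0 m0' w w' \<and>
    (\<forall>\<nu> \<in> {1..num_digits M}.
      (\<exists>p \<in> half_lattice. symmetric_wrt p (w \<nu>) \<or> antisymmetric_wrt p (w \<nu>)) \<and>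
      (\<exists>p \<in> half_lattice. symmetric_wrt p (w' \<nu>) \<or> antisymmetric_wrt p (w' \<nu>)) \<and>
      vanishing_moments n (w' \<nu>))"
proof -
  interpret dilation_digits M s D'
    by unfold_locales fact+
  obtain \<kappa> where \<kappa>: "2 *\<^sub>R c = real_vec \<kappa>"
    using assms(6) unfolding half_lattice_def by auto
  have "\<exists>j' l. j' < m \<and> \<kappa> - s j = s j' + M *v l" for j
    using digit_index by blast
  then obtain \<sigma> L where "\<And>j. \<sigma> j < m" "\<And>j. \<kappa> - s j = s (\<sigma> j) + M *v L j"
    by metis
  then interpret reflected_digits M s D' \<kappa> \<sigma> L
    by unfold_locales
  have sym: "\<And>\<xi>. m0 \<xi> = character (real_vec \<kappa>) \<xi> * m0 (- \<xi>)" "\<And>\<xi>. m0' \<xi> = character (real_vec \<kappa>) \<xi> * m0' (- \<xi>)"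
    using assms(10,11) unfolding symmetric_wrt_def \<kappa> by blast+
  have tp: "trig_poly m0" "trig_poly m0'"
    using assms(8,9) unfolding refinable_mask_def by blast+
  obtain \<tau> \<tau>' where \<tau>: "polyphase_components M s m0 \<tau>" and \<tau>': "polyphase_components M s m0' \<tau>'"
    using polyphase_exists tp by blast
  define e where "e j k = (if j = k then 1 else 0 :: complex)" for j k :: nat
  define f where "f j k \<omega> = e j k - cnj (\<tau> j \<omega>) * \<tau>' k \<omega>" for j k \<omega>
  \<comment> \<open>Wavelet masks are numbered from 1 and digits from 0.\<close>
  define w where "w \<nu> \<xi> = mix (\<lambda>j. digit_mask j \<xi>) (\<nu> - 1)" for \<nu> \<xi>
  define w' where "w' \<nu> \<xi> = mix (\<lambda>j. dual_digit_mask \<tau> m0' j \<xi>) (\<nu> - 1)" for \<nu> \<xi>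
  define \<mu> where "\<mu> \<nu> = (if \<nu> = 0 then \<tau> else (\<lambda>k \<omega>. mix (\<lambda>j. e j k) (\<nu> - 1)))" for \<nu>
  define \<mu>' where "\<mu>' \<nu> = (if \<nu> = 0 then \<tau>' else (\<lambda>k \<omega>. mix (\<lambda>j. f j k \<omega>) (\<nu> - 1)))" for \<nu>
  have dual: "trig_poly (dual_digit_mask \<tau> m0' j)" if "j < m" for j
    using trig_poly_dual_digit_mask \<tau> tp(2) that unfolding polyphase_components_def by blast
  have masks: "trig_poly (w \<nu>)" "trig_poly (w' \<nu>)" "flat n 0 (w' \<nu>)" if "\<nu> \<in> {1..m}" for \<nu>
  proof -
    have \<nu>: "\<nu> - 1 < m" using that by auto
    show "trig_poly (w \<nu>)" "trig_poly (w' \<nu>)"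
      unfolding w_def w'_def by (intro trig_poly_mix trig_poly_digit_mask dual \<nu>; assumption)+
    have "trig_poly (\<lambda>\<xi>. 1 - m0 \<xi> * cnj (m0' \<xi>))"
      by (intro trig_poly_diff trig_poly_mult trig_poly_cnj trig_poly_const tp)
    then have "flat n 0 (\<lambda>\<xi>. 1 - m0 \<xi> * cnj (m0' \<xi>))"
      using assms(13) by (simp add: flat_iff_multi_deriv trig_poly_exp_sums)
    from flat_dual_digit_mask[OF tp(1) assms(12,5) \<tau> _ tp(2) this]
    show "flat n 0 (w' \<nu>)"
      unfolding w'_def by (intro flat_mix dual \<nu>)
  qed
  have poly: "polyphase_components M s ((w(0 := m0)) \<nu>) (\<mu> \<nu>)"
    "polyphase_components M s ((w'(0 := m0')) \<nu>) (\<mu>' \<nu>)" if "\<nu> \<le> m" for \<nu>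
  proof -
    have "polyphase_components M s (w \<nu>) (\<mu> \<nu>) \<and> polyphase_components M s (w' \<nu>) (\<mu>' \<nu>)" if "\<nu> \<noteq> 0"
    proof -
      have \<nu>: "\<nu> - 1 < m" using that \<open>\<nu> \<le> m\<close> by auto
      show ?thesis
        using polyphase_mix[OF polyphase_digit_mask \<nu>] polyphase_mix[OF polyphase_dual_digit_mask[OF \<tau> \<tau>'] \<nu>] that
        by (simp add: w_def[abs_def] w'_def[abs_def] \<mu>_def \<mu>'_def f_def e_def)
    qed
    then show "polyphase_components M s ((w(0 := m0)) \<nu>) (\<mu> \<nu>)"
      "polyphase_components M s ((w'(0 := m0')) \<nu>) (\<mu>' \<nu>)"
      using \<tau> \<tau>' by (auto simp: \<mu>_def \<mu>'_def)
  qed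
  have "(\<Sum>\<nu>\<le>m. \<mu> \<nu> j \<xi> * cnj (\<mu>' \<nu> k \<xi>)) = (if j = k then 1 else 0)" if "j < m" for j k \<xi>
  proof -
    have "(\<Sum>\<nu>\<le>m. \<mu> \<nu> j \<xi> * cnj (\<mu>' \<nu> k \<xi>)) = \<tau> j \<xi> * cnj (\<tau>' k \<xi>) +
        (\<Sum>i<m. mix (\<lambda>i. e i j) i * mix (\<lambda>i. cnj (f i k \<xi>)) i)"
      by (simp add: sum.atMost_shift \<mu>_def \<mu>'_def cnj_mix)
    also have "\<dots> = \<tau> j \<xi> * cnj (\<tau>' k \<xi>) + cnj (f j k \<xi>)"
      using mix_orthogonal[OF that] by (simp add: e_def)
    also have "\<dots> = (if j = k then 1 else 0)"
      by (simp add: f_def e_def)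
    finally show ?thesis .
  qed
  with masks poly have "wavelet_masks M s m0 m0' w w'"
    unfolding wavelet_masks_def by blast
  moreover have "(\<exists>p \<in> half_lattice. symmetric_wrt p (w \<nu>) \<or> antisymmetric_wrt p (w \<nu>)) \<and>
      (\<exists>p \<in> half_lattice. symmetric_wrt p (w' \<nu>) \<or> antisymmetric_wrt p (w' \<nu>)) \<and>
      vanishing_moments n (w' \<nu>)" if "\<nu> \<in> {1..m}" for \<nu>
  proof -
    have \<nu>: "\<nu> - 1 < m" using that by auto
    have "vanishing_moments n (w' \<nu>)"
      using masks[OF that] flat_imp_multi_deriv_eq_0 unfolding vanishing_moments_def by blast
    then show ?thesis
      using mix_symmetric[OF digit_mask_reflects \<nu>]
        mix_symmetric[OF dual_digit_mask_reflects[OF \<tau> sym] \<nu>]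
      by (simp add: w_def[abs_def] w'_def[abs_def])
  qed
  ultimately show ?thesis by blast
qed

end
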